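(* Let $\mathcal{D}=\{X\in\mathcal{S}^n:\ \operatorname{rank}(X)\le k,\ f(\lambda(X))\le 0\}$, let $\tilde k\le k$ be its strengthened rank, and for $s\in[\tilde k+1]$ let $$\mathcal{Y}^s:=\{X\in\mathcal{S}^n:\ \exists x\in\mathbb{R}^n,\ f(x)\le0,\ x_1\ge\cdots\ge x_n,\ x_s=x_{s+n-\tilde k-1}=0,\ x\succeq\lambda(X)\}.$$ Consider $$V_{\rm rel\text{-}I}:=\min_{s\in[\tilde k+1]}\ \min_{X\in\mathcal{Y}^s}\{\langle A_0,X\rangle:\ b_i^l\le\langle A_i,X\rangle\le b_i^u,\ \forall i\in[m]\}\qquad\text{(LSOP-R-I)},$$ and let $\tilde m$ be the number of linearly independent matrices among $A_1,\dots,A_m$. Suppose that the inner minimization of LSOP-R-I always (for every $s\in[\tilde k+1]$) admits a feasible set containing no line. Then: (i) for each $s\in[\tilde k+1]$, every extreme point of the feasible set of the $s$th inner minimization has rank at most $\tilde k+\lfloor\sqrt{2\tilde m+9/4}-3/2\rfloor$ if $s\in\{1,\tilde k+1\}$, and at most $\tilde k+\lfloor\sqrt{4\tilde m+9}-3\rfloor$ otherwise; (ii) there exists an optimal solution to LSOP-R-I of rank at most $\tilde k+\lfloor\sqrt{4\tilde m+9}-3\rfloor$ if LSOP-R-I yields a finite optimal value, i.e., $V_{\rm rel\text{-}I}>-\infty$.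
   Context: $k\le n$ are positive integers; $[m]=\{1,\dots,m\}$; $\mathcal{S}^n$ is the space of $n\times n$ real symmetric matrices; $\langle\cdot,\cdot\rangle$ is the Frobenius inner product; $\operatorname{conv}$ denotes convex hull. $\lambda(X)\in\mathbb{R}^n$ is the vector of eigenvalues of $X$. The function $f:\mathbb{R}^n\to\mathbb{R}$ is continuous, convex and symmetric (invariant under permutations of its arguments). $A_0,A_1,\dots,A_m\in\mathcal{S}^n$ and $-\infty\le b_i^l\le b_i^u\le+\infty$. The number $\tilde m$ is the dimension of the linear span of $\{A_i\}_{i\in[m]}$. Majorization: $x\succeq y$ for $x,y\in\mathbb{R}^n$ means that for every $\ell\in[n]$ the sum of the $\ell$ largest entries of $x$ is at least the sum of the $\ell$ largest entries of $y$, and $\sum_i x_i=\sum_i y_i$. Strengthened rank: $\tilde k$ with $1\le\tilde k\le k$ is the smallest integer such that $\operatorname{conv}(\mathcal{D})=\operatorname{conv}(\{X\in\mathcal{S}^n:\ \operatorname{rank}(X)\le\tilde k,\ f(\lambda(X))\le0\})$.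
   Formalization: In (ii), besides V_rel-I > -∞, the minimum is assumed to be attained (some optimal solution exists): a finite infimum need not be attained, and then (ii) fails. If k̃ = n, the condition x_s = x_{s+n-k̃-1} = 0, whose indices may leave [n], is dropped. *)

theory Defs
  imports "HOL-Analysis.Analysis"
begin

text \<open>
  The index type carries a linear order, which identifies it with \<open>{1..n}\<close> for
  \<open>n = CARD('n)\<close>. Thus \<open>vec_comp x i\<close> is the component $x_i$ and is meaningful only for
  \<open>1 \<le> i \<le> n\<close>.
\<close>

type_synonym 'n sqmat = "real ^ 'n ^ 'n"

definition entries :: "real ^ 'n::{finite,linorder} \<Rightarrow> real list" where
  "entries x = map (\<lambda>j. x $ j) (sorted_list_of_set UNIV)"

definition vec_comp :: "real ^ 'n::{finite,linorder} \<Rightarrow> nat \<Rightarrow> real" where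
  "vec_comp x i = entries x ! (i - 1)"

definition nonincreasing :: "real ^ 'n::{finite,linorder} \<Rightarrow> bool" where
  "nonincreasing x \<longleftrightarrow> (\<forall>i j. i \<le> j \<longrightarrow> x $ j \<le> x $ i)"

definition symmetric_fun :: "(real ^ 'n \<Rightarrow> real) \<Rightarrow> bool" where
  "symmetric_fun f \<longleftrightarrow> (\<forall>p x. p permutes UNIV \<longrightarrow> f (\<chi> i. x $ p i) = f x)"

definition sum_largest :: "nat \<Rightarrow> real ^ 'n::{finite,linorder} \<Rightarrow> real" where
  "sum_largest l x = sum_list (take l (rev (sort (entries x))))"

definition majorizes ::
    "real ^ 'n::{finite,linorder} \<Rightarrow> real ^ 'n::{finite,linorder} \<Rightarrow> bool"
    (infix \<open>\<succeq>\<close> 50) where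
  "x \<succeq> y \<longleftrightarrow>
     (\<forall>l\<in>{1..CARD('n)}. sum_largest l x \<ge> sum_largest l y) \<and>
     (\<Sum>i\<in>UNIV. x $ i) = (\<Sum>i\<in>UNIV. y $ i)"

definition sym_matrices :: "(real ^ 'n ^ 'n) set" where
  "sym_matrices = {X. transpose X = X}"

text \<open>
  Eigenvalues are repeated according to their multiplicity as roots of the characteristic
  polynomial and listed in nonincreasing order. For a symmetric matrix exactly one vector
  satisfies this; for other matrices the value is irrelevant.
\<close>

definition eigvals :: "'n::{finite,linorder} sqmat \<Rightarrow> real ^ 'n::{finite,linorder}" where
  "eigvals X = (SOME v. nonincreasing v \<and>
     (\<forall>t. det (mat t - X) = (\<Prod>i\<in>UNIV. t - v $ i)))"

definition spectral_rank_set ::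
    "(real ^ 'n::{finite,linorder} \<Rightarrow> real) \<Rightarrow> nat \<Rightarrow> ('n::{finite,linorder} sqmat) set" where
  "spectral_rank_set f k = {X \<in> sym_matrices. rank X \<le> k \<and> f (eigvals X) \<le> 0}"

definition strengthened_rank ::
    "(real ^ 'n::{finite,linorder} \<Rightarrow> real) \<Rightarrow> nat \<Rightarrow> nat" where
  "strengthened_rank f k = (LEAST r. 1 \<le> r \<and> r \<le> k \<and>
     convex hull (spectral_rank_set f k) = convex hull (spectral_rank_set f r))"

text \<open>
  The set $\mathcal{Y}^s$ for strengthened rank \<open>r\<close>. On nonincreasing \<open>x\<close> the two equations make
  the block of \<open>n - r\<close> components from position \<open>s\<close> to position \<open>s + n - r - 1\<close> vanish. For
  \<open>r = n\<close> this block is empty and the positions may lie outside \<open>{1..n}\<close>, so nothing is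
  required then.
\<close>

definition relax_set ::
    "(real ^ 'n::{finite,linorder} \<Rightarrow> real) \<Rightarrow> nat \<Rightarrow> nat \<Rightarrow> ('n::{finite,linorder} sqmat) set" where
  "relax_set f r s = {X \<in> sym_matrices. \<exists>x. f x \<le> 0 \<and> nonincreasing x \<and>
     (r < CARD('n) \<longrightarrow> vec_comp x s = 0 \<and> vec_comp x (s + CARD('n) - r - 1) = 0) \<and>
     x \<succeq> eigvals X}"

text \<open>
  On matrices \<open>\<bullet>\<close> is the Frobenius inner product.
\<close>

definition feasible_set ::
    "(real ^ 'n::{finite,linorder} \<Rightarrow> real) \<Rightarrow> nat \<Rightarrow> (nat \<Rightarrow> 'n::{finite,linorder} sqmat) \<Rightarrow>
     (nat \<Rightarrow> ereal) \<Rightarrow> (nat \<Rightarrow> ereal) \<Rightarrow> nat \<Rightarrow> nat \<Rightarrow> ('n::{finite,linorder} sqmat) set" where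
  "feasible_set f r A bl bu m s =
     {X \<in> relax_set f r s. \<forall>i\<in>{1..m}. bl i \<le> ereal (A i \<bullet> X) \<and> ereal (A i \<bullet> X) \<le> bu i}"

text \<open>
  The optimal value is an infimum (\<open>\<infinity>\<close> if the problem is infeasible). A finite infimum need
  not be attained, because the feasible sets may be unbounded.
\<close>

definition opt_value ::
    "(real ^ 'n::{finite,linorder} \<Rightarrow> real) \<Rightarrow> nat \<Rightarrow> (nat \<Rightarrow> 'n::{finite,linorder} sqmat) \<Rightarrow>
     (nat \<Rightarrow> ereal) \<Rightarrow> (nat \<Rightarrow> ereal) \<Rightarrow> nat \<Rightarrow> ereal" where
  "opt_value f r A bl bu m =
     (INF s\<in>{1..r + 1}. INF X\<in>feasible_set f r A bl bu m s. ereal (A 0 \<bullet> X))"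

definition optimal_solution ::
    "(real ^ 'n::{finite,linorder} \<Rightarrow> real) \<Rightarrow> nat \<Rightarrow> (nat \<Rightarrow> 'n::{finite,linorder} sqmat) \<Rightarrow>
     (nat \<Rightarrow> ereal) \<Rightarrow> (nat \<Rightarrow> ereal) \<Rightarrow> nat \<Rightarrow> 'n::{finite,linorder} sqmat \<Rightarrow> bool" where
  "optimal_solution f r A bl bu m X \<longleftrightarrow>
     (\<exists>s\<in>{1..r + 1}. X \<in> feasible_set f r A bl bu m s) \<and>
     ereal (A 0 \<bullet> X) = opt_value f r A bl bu m"

definition contains_line :: "'a::real_vector set \<Rightarrow> bool" where
  "contains_line S \<longleftrightarrow> (\<exists>a d. d \<noteq> 0 \<and> (\<forall>t::real. a + t *\<^sub>R d \<in> S))"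

end

theory Submission
  imports Defs
begin

text \<open>
  Write \<open>n\<close> for the order of the matrices and \<open>S l\<close> for sums of \<open>l\<close> leading entries. Let \<open>X\<close> be
  feasible for the index \<open>s\<close> with witness \<open>x\<close>. The zero block of length \<open>n - r\<close> leaves
  \<open>u = s - 1\<close> entries of \<open>x\<close> in front of it, all nonnegative, and \<open>r - u\<close> entries behind it, all
  nonpositive. If \<open>X\<close> has \<open>p = u + e1\<close> positive eigenvalues with \<open>e1 > 0\<close>, then
  \<open>S l \<lambda>(X) < S l x\<close> for \<open>u \<le> l < p\<close>: on this range the left side is still strictly increasing,
  while the right side has already stopped growing. Because of this slack \<open>X\<close> can be
  perturbed in both directions by any small symmetric traceless matrix supported on the \<open>e1 + 1\<close>
  eigenvectors with indices \<open>u, ..., p\<close> (counted from 1) without leaving the set of matrices whose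
  spectrum is majorized by the same \<open>x\<close>. The negative eigenvalues, with excess \<open>e2\<close>, give a second,
  independent block.

  The two blocks provide a space of dimension
  \<open>(e1 + 1) (e1 + 2) / 2 - 1 + (e2 + 1) (e2 + 2) / 2 - 1 = (e1\<^sup>2 + 3 e1 + e2\<^sup>2 + 3 e2) / 2\<close>.
  If this exceeds the number of linearly independent constraint matrices, some nonzero
  perturbation is orthogonal to all of them, and \<open>X\<close> is not extreme. So \<open>X\<close> extreme forces
  \<open>e1\<^sup>2 + 3 e1 + e2\<^sup>2 + 3 e2 \<le> 2 m'\<close> with \<open>m'\<close> that number, whereas \<open>rank X \<le> r + e1 + e2\<close>; moreover
  \<open>s = 1\<close> excludes positive and \<open>s = r + 1\<close> excludes negative eigenvalues. Maximizing
  \<open>e1 + e2\<close> gives the bounds. The dichotomy is \<open>perturbable_or_low_rank\<close>.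

  To compare spectra of perturbed matrices, Ky Fan's principle (\<open>majorizes_eigvals_iff\<close>) replaces
  \<open>S l \<lambda>(X)\<close> by a maximum of functionals that are linear in \<open>X\<close>, one for each orthonormal set of
  size \<open>l\<close>. This rests on the spectral theorem, which also identifies the vector of
  eigenvalues.

  For the optimal solution, the set of optimal matrices need not be closed in any obvious way,
  since witnesses may be unbounded. But the set of pairs of an optimal matrix and a witness is
  closed and convex, and it contains no line because the feasible set contains none. So it has an
  extreme point \<open>(X, x)\<close>. The perturbations above keep \<open>x\<close> fixed and, by optimality, keep the
  objective value, so the same count bounds the rank of \<open>X\<close>.
\<close>

section \<open>Orthonormal sets and the spectral theorem\<close>

definition orthonormal :: "'a::euclidean_space set \<Rightarrow> bool" where
  "orthonormal B \<longleftrightarrow> pairwise orthogonal B \<and> (\<forall>b\<in>B. norm b = 1)"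

lemma orthonormal_independent:
  assumes "orthonormal B"
  shows "independent B"
  using assms pairwise_orthogonal_independent[of B] unfolding orthonormal_def by fastforce

lemma orthonormal_finite: "orthonormal B \<Longrightarrow> finite B"
  by (simp add: orthonormal_independent independent_imp_finite)

lemma orthonormal_inner:
  assumes "orthonormal B" "u \<in> B" "v \<in> B"
  shows "u \<bullet> v = (if u = v then 1 else 0)"
  using assms unfolding orthonormal_def pairwise_def orthogonal_def
  by (auto simp: norm_eq_1)

lemma orthonormal_extend_to_basis:
  fixes B :: "'a::euclidean_space set"
  assumes "orthonormal B"
  obtains C where "B \<subseteq> C" "orthonormal C" "span C = UNIV"
proof -
  obtain U where U: "U \<inter> (insert 0 B) = {}" "pairwise orthogonal (B \<union> U)"
      "span (B \<union> U) = span (B \<union> UNIV)"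
    using orthogonal_extension_strong assms unfolding orthonormal_def by blast
  define N where "N = (\<lambda>x::'a. x /\<^sub>R norm x)"
  have NB: "N ` B = B"
    using assms unfolding orthonormal_def N_def by (auto simp: image_def)
  have nz: "x \<noteq> 0" if "x \<in> B \<union> U" for x
    using that U(1) assms unfolding orthonormal_def by fastforce
  have "orthonormal (N ` (B \<union> U))"
    unfolding orthonormal_def
  proof
    show "pairwise orthogonal (N ` (B \<union> U))"
      using U(2) unfolding pairwise_image N_def
      by (auto simp: pairwise_def orthogonal_clauses)
    show "\<forall>b\<in>N ` (B \<union> U). norm b = 1"
      using nz unfolding N_def by auto
  qed
  moreover have "span (N ` (B \<union> U)) = UNIV"
  proof -
    have "B \<union> U \<subseteq> span (N ` (B \<union> U))"
    proof
      fix x assume x: "x \<in> B \<union> U"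
      have "x = norm x *\<^sub>R N x" using nz[OF x] by (simp add: N_def)
      then show "x \<in> span (N ` (B \<union> U))"
        by (metis imageI span_base span_scale x)
    qed
    then have "span (B \<union> U) \<subseteq> span (N ` (B \<union> U))"
      by (simp add: span_minimal)
    then show ?thesis using U(3) by auto
  qed
  moreover have "B \<subseteq> N ` (B \<union> U)" using NB by auto
  ultimately show ?thesis using that by blast
qed

lemma orthonormal_expand:
  fixes C :: "'a::euclidean_space set"
  assumes "orthonormal C" "span C = UNIV"
  shows "(\<Sum>b\<in>C. (x \<bullet> b) *\<^sub>R b) = x"
  using assms orthonormal_basis_expand[of C x] orthonormal_finite[of C]
  unfolding orthonormal_def by auto

lemma parseval:
  fixes C :: "'a::euclidean_space set"
  assumes "orthonormal C" "span C = UNIV"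
  shows "x \<bullet> y = (\<Sum>b\<in>C. (x \<bullet> b) * (y \<bullet> b))"
proof -
  have "x \<bullet> y = (\<Sum>b\<in>C. (x \<bullet> b) *\<^sub>R b) \<bullet> y"
    using orthonormal_expand[OF assms] by simp
  also have "\<dots> = (\<Sum>b\<in>C. (x \<bullet> b) * (y \<bullet> b))"
    unfolding inner_sum_left by (simp add: inner_commute[of y])
  finally show ?thesis .
qed

lemma bessel:
  fixes B :: "'a::euclidean_space set"
  assumes "orthonormal B"
  shows "(\<Sum>b\<in>B. (x \<bullet> b)\<^sup>2) \<le> x \<bullet> x"
proof -
  obtain C where C: "B \<subseteq> C" "orthonormal C" "span C = UNIV"
    using orthonormal_extend_to_basis[OF assms] .
  have "(\<Sum>b\<in>B. (x \<bullet> b)\<^sup>2) \<le> (\<Sum>b\<in>C. (x \<bullet> b)\<^sup>2)"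
    using C orthonormal_finite by (intro sum_mono2) auto
  then show ?thesis using parseval[OF C(2,3), of x x] by (simp add: power2_eq_square)
qed

lemma trace_eq_sum_orthonormal:
  fixes Y :: "real^'n^'n"
  assumes "orthonormal C" "span C = UNIV"
  shows "trace Y = (\<Sum>v\<in>C. v \<bullet> (Y *v v))"
proof -
  have Yv: "(\<Sum>v\<in>C. (v $ i) * (Y *v v) $ i) = Y $ i $ i" for i
  proof -
    have "axis i 1 = (\<Sum>v\<in>C. (v $ i) *\<^sub>R v)"
      using orthonormal_expand[OF assms, of "axis i 1"] by (simp add: inner_axis')
    then have "Y *v axis i 1 = (\<Sum>v\<in>C. (v $ i) *\<^sub>R (Y *v v))"
      by (simp add: matrix_vector_mult_scaleR linear_sum[OF matrix_vector_mul_linear])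
    then have "(Y *v axis i 1) $ i = (\<Sum>v\<in>C. (v $ i) * (Y *v v) $ i)" by simp
    moreover have "(Y *v axis i 1) $ i = Y $ i $ i"
      by (simp add: matrix_vector_mult_basis column_def)
    ultimately show ?thesis by simp
  qed
  have "(\<Sum>v\<in>C. v \<bullet> (Y *v v)) = (\<Sum>i\<in>UNIV. \<Sum>v\<in>C. (v $ i) * (Y *v v) $ i)"
    by (simp add: inner_vec_def) (rule sum.swap)
  then show ?thesis using Yv by (simp add: trace_def)
qed

lemma sym_matrix_self_adjoint:
  assumes "X \<in> sym_matrices"
  shows "x \<bullet> (X *v y) = (X *v x) \<bullet> y"
proof -
  have "transpose X = X" using assms by (simp add: sym_matrices_def)
  then have "x v* X = X *v x" using transpose_matrix_vector[of X x] by simp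
  then show ?thesis using dot_lmul_matrix[of x X y] by simp
qed

text \<open>
  The maximum \<open>\<mu>\<close> of the Rayleigh quotient makes \<open>\<mu> (v \<bullet> v) - v \<bullet> f v\<close> a nonnegative form on
  \<open>S\<close> which vanishes at the maximiser, so the maximiser is in its kernel.
\<close>

lemma self_adjoint_has_eigenvector:
  fixes f :: "'a::euclidean_space \<Rightarrow> 'a"
  assumes f: "linear f" and adj: "\<And>x y. x \<bullet> f y = f x \<bullet> y"
    and S: "subspace S" "f ` S \<subseteq> S" "S \<noteq> {0}"
  obtains u \<mu> where "u \<in> S" "norm u = 1" "f u = \<mu> *\<^sub>R u"
proof -
  let ?K = "S \<inter> sphere 0 1"
  have "compact ?K" by (intro closed_Int_compact closed_subspace S) simp
  moreover have "?K \<noteq> {}"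
  proof -
    obtain x where "x \<in> S" "x \<noteq> 0" using S using subspace_0 by blast
    then have "x /\<^sub>R norm x \<in> ?K" using S(1) by (simp add: subspace_scale)
    then show ?thesis by blast
  qed
  moreover have "continuous_on ?K (\<lambda>v. v \<bullet> f v)"
    by (intro continuous_intros linear_continuous_on linear_conv_bounded_linear[THEN iffD1, OF f])
  ultimately obtain u where u: "u \<in> ?K" and max: "\<And>v. v \<in> ?K \<Longrightarrow> v \<bullet> f v \<le> u \<bullet> f u"
    using continuous_attains_sup[of ?K "\<lambda>v. v \<bullet> f v"] by blast
  define \<mu> where "\<mu> = u \<bullet> f u"
  define Q where "Q = (\<lambda>v. \<mu> * (v \<bullet> v) - v \<bullet> f v)"
  have Q: "Q v \<ge> 0" if v: "v \<in> S" for v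
  proof (cases "v = 0")
    case False
    have "(v /\<^sub>R norm v) \<bullet> f (v /\<^sub>R norm v) \<le> \<mu>"
      using max[of "v /\<^sub>R norm v"] v False S(1) by (simp add: \<mu>_def subspace_scale)
    then have "(v \<bullet> f v) / (v \<bullet> v) \<le> \<mu>"
      using False by (simp add: linear_scale[OF f] dot_square_norm field_simps power2_eq_square)
    then show ?thesis using False by (simp add: Q_def field_simps)
  qed (simp add: Q_def linear_0[OF f])
  have uS: "u \<in> S" "norm u = 1" "u \<bullet> u = 1" using u by (auto simp: norm_eq_1)
  have Qu: "Q u = 0" using uS by (simp add: Q_def \<mu>_def)
  define w where "w = f u - \<mu> *\<^sub>R u"
  have wS: "w \<in> S" using S uS by (auto simp: w_def subspace_diff subspace_scale)
  have exp: "Q (u - t *\<^sub>R w) = 2 * t * (w \<bullet> w) + t\<^sup>2 * Q w" for t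
  proof -
    have 1: "(u - t *\<^sub>R w) \<bullet> (u - t *\<^sub>R w) = u \<bullet> u - 2 * t * (u \<bullet> w) + t\<^sup>2 * (w \<bullet> w)"
      by (simp add: inner_diff_left inner_diff_right inner_commute[of w u] power2_eq_square algebra_simps)
    have "(u - t *\<^sub>R w) \<bullet> f (u - t *\<^sub>R w) = (u - t *\<^sub>R w) \<bullet> (f u - t *\<^sub>R f w)"
      by (simp add: linear_diff[OF f] linear_scale[OF f])
    also have "\<dots> = u \<bullet> f u - 2 * t * (f u \<bullet> w) + t\<^sup>2 * (w \<bullet> f w)"
      by (simp add: inner_diff_left inner_diff_right inner_commute[of w "f u"] adj[of u w]
          power2_eq_square algebra_simps)
    finally have "Q (u - t *\<^sub>R w) = Q u + 2 * t * (f u \<bullet> w - \<mu> * (u \<bullet> w)) + t\<^sup>2 * Q w"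
      unfolding Q_def 1 by (simp add: algebra_simps)
    also have "f u \<bullet> w - \<mu> * (u \<bullet> w) = w \<bullet> w"
      by (simp add: w_def inner_diff_left)
    finally show ?thesis using Qu by simp
  qed
  have "w \<bullet> w = 0"
  proof (rule ccontr)
    assume "w \<bullet> w \<noteq> 0"
    then have pos: "w \<bullet> w > 0" by simp
    define c where "c = w \<bullet> w"
    define d where "d = Q w"
    have ge: "2 * t * c + t\<^sup>2 * d \<ge> 0" for t
      using exp[of t] Q[of "u - t *\<^sub>R w"] wS uS S(1)
      by (simp add: c_def d_def subspace_diff subspace_scale)
    have c: "c > 0" using pos by (simp add: c_def)
    have d: "d \<ge> 0" using Q[OF wS] by (simp add: d_def)
    define r where "r = c / (d + 1)"
    have "c = r * (d + 1)" "r > 0" using c d by (simp_all add: r_def)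
    then have "2 * (- r) * c + (- r)\<^sup>2 * d = - (r\<^sup>2 * (d + 2))"
      by (simp add: power2_eq_square algebra_simps)
    moreover have "r\<^sup>2 * (d + 2) > 0" using \<open>r > 0\<close> d by simp
    ultimately show False using ge[of "- r"] by linarith
  qed
  then have "f u = \<mu> *\<^sub>R u" by (simp add: w_def)
  then show ?thesis using that uS by blast
qed

lemma self_adjoint_eigenbasis:
  fixes f :: "'a::euclidean_space \<Rightarrow> 'a"
  assumes f: "linear f" and adj: "\<And>x y. x \<bullet> f y = f x \<bullet> y"
    and S: "subspace S" "f ` S \<subseteq> S"
  shows "\<exists>B. orthonormal B \<and> span B = S \<and> (\<forall>b\<in>B. \<exists>\<mu>. f b = \<mu> *\<^sub>R b)"
  using S
proof (induction "dim S" arbitrary: S rule: less_induct)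
  case less
  show ?case
  proof (cases "S = {0}")
    case True
    then show ?thesis by (intro exI[of _ "{}"]) (simp add: orthonormal_def)
  next
    case False
    obtain u \<mu> where u: "u \<in> S" "norm u = 1" "f u = \<mu> *\<^sub>R u"
      using self_adjoint_has_eigenvector[OF f adj less.prems False] .
    have uu: "u \<bullet> u = 1" using u(2) by (simp add: norm_eq_1)
    define T where "T = {x \<in> S. u \<bullet> x = 0}"
    have T: "subspace T"
      using less.prems(1) unfolding T_def subspace_def by (simp add: inner_add_right)
    have fT: "f ` T \<subseteq> T"
    proof
      fix y assume "y \<in> f ` T"
      then obtain x where x: "x \<in> S" "u \<bullet> x = 0" "y = f x" by (auto simp: T_def)
      have "u \<bullet> y = \<mu> * (u \<bullet> x)" using x u(3) adj by simp
      then show "y \<in> T" using x less.prems(2) by (auto simp: T_def)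
    qed
    have "u \<notin> T" using uu by (simp add: T_def)
    moreover have "T \<subseteq> S" by (auto simp: T_def)
    ultimately have "T \<subset> S" using u(1) by blast
    then have "dim T < dim S"
      using dim_psubset[of T S] T less.prems(1) by (metis span_eq_iff)
    then obtain B where B: "orthonormal B" "span B = T" "\<forall>b\<in>B. \<exists>\<mu>. f b = \<mu> *\<^sub>R b"
      using less.hyps[OF _ T fT] by blast
    have orth: "u \<bullet> b = 0" if "b \<in> B" for b
      using that B(2) span_base[of b B] by (auto simp: T_def)
    have "orthonormal (insert u B)"
      using B(1) orth u(2) unfolding orthonormal_def
      by (auto simp: pairwise_insert orthogonal_def inner_commute)
    moreover have "span (insert u B) = S"
    proof
      have "B \<subseteq> S" using B(2) span_superset[of B] by (auto simp: T_def)
      then show "span (insert u B) \<subseteq> S"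
        using u(1) less.prems(1) by (simp add: span_minimal)
      show "S \<subseteq> span (insert u B)"
      proof
        fix x assume x: "x \<in> S"
        have "x - (u \<bullet> x) *\<^sub>R u \<in> T"
          using x u(1) uu less.prems(1)
          by (simp add: T_def subspace_diff subspace_scale inner_diff_right)
        then show "x \<in> span (insert u B)" using B(2) span_breakdown_eq by metis
      qed
    qed
    ultimately show ?thesis using B(3) u(3) by blast
  qed
qed

section \<open>Eigenvalues as a sorted vector\<close>

text \<open>
  The increasing enumeration of the index type, from 0 on: the component \<open>vec_comp x i\<close> is
  \<open>x $ idx (i - 1)\<close>.
\<close>

definition idx :: "nat \<Rightarrow> 'n::{finite,linorder}" where
  "idx i = sorted_list_of_set UNIV ! i"

lemma bij_betw_idx: "bij_betw (idx :: nat \<Rightarrow> 'n::{finite,linorder}) {..<CARD('n)} UNIV"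
proof -
  have "bij_betw ((!) (sorted_list_of_set (UNIV::'n set)))
     {..<length (sorted_list_of_set (UNIV::'n set))} (set (sorted_list_of_set (UNIV::'n set)))"
    by (rule bij_betw_nth) auto
  then show ?thesis by (simp add: idx_def[abs_def])
qed

lemma idx_mono:
  assumes "i \<le> j" "j < CARD('n)"
  shows "(idx i :: 'n::{finite,linorder}) \<le> idx j"
  using assms sorted_nth_mono[of "sorted_list_of_set (UNIV::'n set)" i j] by (simp add: idx_def)

lemma idx_eq_iff:
  assumes "i < CARD('n)" "j < CARD('n)"
  shows "(idx i :: 'n::{finite,linorder}) = idx j \<longleftrightarrow> i = j"
  using assms bij_betw_idx[where 'n='n] unfolding bij_betw_def inj_on_def by auto

lemma idx_surj:
  obtains i where "i < CARD('n)" "(j :: 'n::{finite,linorder}) = idx i"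
  using bij_betw_idx[where 'n='n] unfolding bij_betw_def by (metis UNIV_I imageE lessThan_iff)

lemma entries_eq: "entries (x :: real^'n::{finite,linorder}) = map (\<lambda>i. x $ idx i) [0..<CARD('n)]"
  by (rule nth_equalityI) (auto simp: entries_def idx_def)

lemma sum_idx: "(\<Sum>j\<in>UNIV. g (j::'n::{finite,linorder})) = (\<Sum>i<CARD('n). g (idx i))"
  using sum.reindex_bij_betw[OF bij_betw_idx, of g] by simp

lemma vec_comp_eq:
  assumes "i - 1 < CARD('n)"
  shows "vec_comp (x :: real^'n::{finite,linorder}) i = x $ idx (i - 1)"
  using assms by (simp add: vec_comp_def entries_eq)

lemma nonincreasing_idx:
  assumes "nonincreasing (x :: real^'n::{finite,linorder})" "i \<le> j" "j < CARD('n)"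
  shows "x $ idx j \<le> x $ idx i"
  using assms idx_mono unfolding nonincreasing_def by blast

lemma sum_largest_nonincreasing:
  fixes x :: "real^'n::{finite,linorder}"
  assumes "nonincreasing x" "l \<le> CARD('n)"
  shows "sum_largest l x = (\<Sum>i<l. x $ idx i)"
proof -
  have "sorted (rev (entries x))"
    using nonincreasing_idx[OF assms(1)]
    by (auto simp: entries_eq sorted_rev_iff_nth_mono)
  then have "sort (entries x) = rev (entries x)"
    by (metis mset_rev properties_for_sort)
  then have "sum_largest l x = sum_list (take l (map (\<lambda>i. x $ idx i) [0..<CARD('n)]))"
    by (simp add: sum_largest_def entries_eq)
  also have "\<dots> = sum_list (map (\<lambda>i. x $ idx i) [0..<l])"
    using assms(2) by (simp add: take_map)
  finally show ?thesis by (simp add: interv_sum_list_conv_sum_set_nat atLeast0LessThan)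
qed

lemma mset_entries: "mset (entries (x :: real^'n::{finite,linorder})) = image_mset (($) x) (mset_set UNIV)"
proof -
  have "mset (entries x) = image_mset (($) x) (mset (sorted_list_of_set UNIV))"
    by (simp add: entries_def)
  also have "mset (sorted_list_of_set (UNIV :: 'n set)) = mset_set UNIV"
    using mset_set_set[of "sorted_list_of_set (UNIV :: 'n set)"] by simp
  finally show ?thesis .
qed

lemma ex_sorted_permutation:
  fixes w :: "real^'n::{finite,linorder}"
  obtains v p where "nonincreasing v" "p permutes UNIV" "\<And>i. v $ i = w $ p i"
proof -
  define xs where "xs = rev (sort (entries w))"
  have len: "length xs = CARD('n)" by (simp add: xs_def entries_eq)
  define pos where "pos = inv_into {..<CARD('n)} (idx :: nat \<Rightarrow> 'n)"
  have pos: "pos (idx i) = i" if "i < CARD('n)" for i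
    unfolding pos_def using bij_betw_idx[where 'n='n] that by (simp add: bij_betw_def inv_into_f_f)
  define v :: "(real, 'n) vec" where "v = (\<chi> j. xs ! pos j)"
  have "entries v = xs"
    by (rule nth_equalityI) (auto simp: entries_eq len v_def pos)
  have "nonincreasing v"
    unfolding nonincreasing_def
  proof (intro allI impI)
    fix i j :: 'n assume ij: "i \<le> j"
    obtain a b where ab: "i = idx a" "a < CARD('n)" "j = idx b" "b < CARD('n)"
      by (metis idx_surj)
    have "a \<le> b"
    proof (rule ccontr)
      assume "\<not> a \<le> b"
      then have "j \<le> i" using idx_mono[of b a, where 'n='n] ab by simp
      then show False using ij ab idx_eq_iff[where 'n='n] \<open>\<not> a \<le> b\<close> by auto
    qed
    then show "v $ j \<le> v $ i"
      using sorted_rev_nth_mono[of xs a b] ab len by (simp add: v_def pos xs_def)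
  qed
  moreover have "mset (entries v) = mset (entries w)"
    using \<open>entries v = xs\<close> by (simp add: xs_def)
  then have "image_mset (($) v) (mset_set UNIV) = image_mset (($) w) (mset_set UNIV)"
    by (simp add: mset_entries)
  then obtain p where "p permutes UNIV" "\<forall>i\<in>UNIV. v $ i = w $ p i"
    using image_mset_eq_implies_permutes[of UNIV "($) v" "($) w"] by auto
  ultimately show ?thesis using that by blast
qed

text \<open>Unique factorisation of real polynomials: the roots of a split polynomial form a multiset.\<close>

lemma prod_linear_factors_eq_permutation:
  fixes v w :: "real^'n"
  assumes "\<And>t. (\<Prod>i\<in>UNIV. t - v $ i) = (\<Prod>i\<in>UNIV. t - w $ i)"
  obtains p where "p permutes UNIV" "\<And>i. v $ i = w $ p i"
proof -
  define P where "P = (\<lambda>u::real^'n. \<Prod>i\<in>UNIV. [:- (u $ i), 1:])"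
  have proots: "proots (P u) = image_mset (($) u) (mset_set UNIV)" for u
  proof -
    have "proots (P u) = (\<Sum>i\<in>UNIV. {#u $ i#})"
      unfolding P_def by (subst proots_prod) auto
    then show ?thesis by (simp add: sum_unfold_sum_mset)
  qed
  have "poly (P v) t = poly (P w) t" for t
    using assms[of t] by (simp add: P_def poly_prod)
  then have "P v = P w" by (metis poly_eqI_degree poly_eq_poly_eq_iff ext)
  then have "image_mset (($) v) (mset_set UNIV) = image_mset (($) w) (mset_set UNIV)"
    using proots by metis
  then show ?thesis
    using image_mset_eq_implies_permutes[of UNIV "($) v" "($) w"] that by auto
qed

lemma det_of_eigenbasis:
  fixes X :: "real^'n^'n" and q :: "'n \<Rightarrow> real^'n"
  assumes orth: "\<And>i j. q i \<bullet> q j = (if i = j then 1 else 0)"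
    and eig: "\<And>i. X *v q i = w $ i *\<^sub>R q i"
  shows "det (mat t - X) = (\<Prod>i\<in>UNIV. t - w $ i)"
proof -
  define Q :: "real^'n^'n" where "Q = (\<chi> i j. q j $ i)"
  define D :: "real^'n^'n" where "D = (\<chi> i j. if i = j then t - w $ i else 0)"
  have "transpose Q ** Q = mat 1"
    using orth by (simp add: Q_def vec_eq_iff matrix_matrix_mult_def transpose_def mat_def inner_vec_def)
  then have "det Q * det Q = 1"
    by (metis det_I det_mul det_transpose)
  then have nz: "det Q \<noteq> 0" by auto
  have "(mat t - X) ** Q = Q ** D"
  proof -
    have "((mat t - X) ** Q) $ i $ j = (Q ** D) $ i $ j" for i j
    proof -
      have "((mat t - X) ** Q) $ i $ j = ((mat t - X) *v q j) $ i"
        by (simp add: matrix_matrix_mult_def matrix_vector_mult_def Q_def)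
      also have "\<dots> = (t *\<^sub>R q j - X *v q j) $ i"
      proof -
        have "mat t *v q j = t *\<^sub>R q j"
          by (simp add: vec_eq_iff matrix_vector_mult_def mat_def if_distrib[of "\<lambda>x. x * _"] cong: if_cong)
        then show ?thesis by (simp add: matrix_vector_mult_diff_rdistrib)
      qed
      also have "\<dots> = q j $ i * (t - w $ j)" by (simp add: eig algebra_simps)
      also have "\<dots> = (Q ** D) $ i $ j"
        by (simp add: matrix_matrix_mult_def Q_def D_def if_distrib[of "\<lambda>x. _ * x"] cong: if_cong)
      finally show ?thesis .
    qed
    then show ?thesis by (simp add: vec_eq_iff)
  qed
  then have "det (mat t - X) * det Q = det Q * det D" by (metis det_mul)
  then have "det (mat t - X) = det D" using nz by simp
  also have "\<dots> = (\<Prod>i\<in>UNIV. t - w $ i)"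
    unfolding D_def by (subst det_diagonal) auto
  finally show ?thesis .
qed

lemma sym_matrix_orthonormal_eigenvectors:
  fixes X :: "real^'n^'n"
  assumes X: "X \<in> sym_matrices"
  obtains q :: "'n \<Rightarrow> real^'n" and w :: "real^'n"
  where "\<And>i j. q i \<bullet> q j = (if i = j then 1 else 0)" "\<And>i. X *v q i = w $ i *\<^sub>R q i"
proof -
  obtain B where B: "orthonormal B" "span B = (UNIV :: (real^'n) set)"
      "\<forall>b\<in>B. \<exists>\<mu>. X *v b = \<mu> *\<^sub>R b"
    using self_adjoint_eigenbasis[of "(*v) X" UNIV] sym_matrix_self_adjoint[OF X] by auto
  have "card B = CARD('n)"
    using dim_eq_card_independent[OF orthonormal_independent[OF B(1)]] dim_span[of B] B(2) by simp
  then have "\<exists>q. bij_betw q (UNIV::'n set) B"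
    by (intro finite_same_card_bij orthonormal_finite[OF B(1)]) simp_all
  then obtain q where q: "bij_betw q (UNIV::'n set) B" ..
  have "\<forall>i. \<exists>\<mu>. X *v q i = \<mu> *\<^sub>R q i"
    using B(3) q by (auto simp: bij_betw_def)
  then obtain \<mu> where "\<And>i. X *v q i = \<mu> i *\<^sub>R q i" by metis
  then have "X *v q i = (\<chi> i. \<mu> i) $ i *\<^sub>R q i" for i by simp
  moreover have "q i \<bullet> q j = (if i = j then 1 else 0)" for i j
    using orthonormal_inner[OF B(1), of "q i" "q j"] q by (auto simp: bij_betw_def inj_on_def)
  ultimately show ?thesis using that by blast
qed

text \<open>
  Sorting the eigenvalues of any orthonormal eigenbasis shows that the property which \<open>eigvals\<close>
  selects is satisfiable. A vector with this property has the roots of the characteristic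
  polynomial as its entries, so a permutation of the eigenbasis fits it.
\<close>

lemma eigvals_eigenbasis:
  fixes X :: "'n::{finite,linorder} sqmat"
  assumes X: "X \<in> sym_matrices"
  obtains q :: "nat \<Rightarrow> real^'n::{finite,linorder}" where "nonincreasing (eigvals X)"
    "\<And>i j. i < CARD('n) \<Longrightarrow> j < CARD('n) \<Longrightarrow> q i \<bullet> q j = (if i = j then 1 else 0)"
    "\<And>i. i < CARD('n) \<Longrightarrow> X *v q i = eigvals X $ idx i *\<^sub>R q i"
proof -
  obtain q :: "'n \<Rightarrow> (real, 'n) vec" and w where
    q: "\<And>i j. q i \<bullet> q j = (if i = j then 1 else 0)" "\<And>i. X *v q i = w $ i *\<^sub>R q i"
    using sym_matrix_orthonormal_eigenvectors[OF X] by blast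
  have det: "det (mat t - X) = (\<Prod>i\<in>UNIV. t - w $ i)" for t
    using det_of_eigenbasis[OF q] .
  obtain v p where vp: "nonincreasing v" "p permutes UNIV" "\<And>i. v $ i = w $ p i"
    using ex_sorted_permutation[of w] by blast
  have "(\<Prod>i\<in>UNIV. t - v $ i) = (\<Prod>i\<in>UNIV. t - w $ i)" for t
    using prod.permute[OF vp(2), of "\<lambda>i. t - w $ i"] vp(3) by (simp add: o_def)
  then have "nonincreasing v \<and> (\<forall>t. det (mat t - X) = (\<Prod>i\<in>UNIV. t - v $ i))"
    using vp(1) det by simp
  then have "nonincreasing (eigvals X) \<and>
      (\<forall>t. det (mat t - X) = (\<Prod>i\<in>UNIV. t - eigvals X $ i))"
    unfolding eigvals_def by (rule someI)
  then have e: "nonincreasing (eigvals X)"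
     "\<And>t. det (mat t - X) = (\<Prod>i\<in>UNIV. t - eigvals X $ i)"
    by blast+
  obtain r where r: "r permutes UNIV" "\<And>i. eigvals X $ i = w $ r i"
    using prod_linear_factors_eq_permutation[of "eigvals X" w] det e(2) by metis
  show ?thesis
  proof (rule that[of "\<lambda>i. q (r (idx i))"])
    fix i j assume "i < CARD('n)" "j < CARD('n)"
    then have "r (idx i) = r (idx j) \<longleftrightarrow> i = j"
      using permutes_inj[OF r(1)] idx_eq_iff[where 'n='n] by (auto simp: inj_def)
    then show "q (r (idx i)) \<bullet> q (r (idx j)) = (if i = j then 1 else 0)" by (simp add: q(1))
  qed (use e(1) q(2) r(2) in auto)
qed

section \<open>Ky Fan's variational description of majorization\<close>

definition orthobasis :: "(nat \<Rightarrow> real^'n) \<Rightarrow> bool" where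
  "orthobasis q \<longleftrightarrow> (\<forall>i<CARD('n). \<forall>j<CARD('n). q i \<bullet> q j = (if i = j then 1 else 0))"

lemma orthobasis_inner:
  assumes "orthobasis (q :: nat \<Rightarrow> real^'n)" "i < CARD('n)" "j < CARD('n)"
  shows "q i \<bullet> q j = (if i = j then 1 else 0)"
  using assms by (simp add: orthobasis_def)

lemma orthobasis_inj:
  assumes "orthobasis (q :: nat \<Rightarrow> real^'n)"
  shows "inj_on q {..<CARD('n)}"
proof (rule inj_onI)
  fix i j assume "i \<in> {..<CARD('n)}" "j \<in> {..<CARD('n)}" "q i = q j"
  then show "i = j"
    using orthobasis_inner[OF assms, of i j] orthobasis_inner[OF assms, of j j] by (auto split: if_splits)
qed

lemma orthobasis_orthonormal:
  assumes "orthobasis (q :: nat \<Rightarrow> real^'n)" "I \<subseteq> {..<CARD('n)}"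
  shows "orthonormal (q ` I)"
  using assms(2) orthobasis_inner[OF assms(1)]
  unfolding orthonormal_def pairwise_def orthogonal_def norm_eq_1
  by (auto simp: subset_iff)

lemma orthobasis_span:
  assumes "orthobasis (q :: nat \<Rightarrow> real^'n)"
  shows "span (q ` {..<CARD('n)}) = UNIV"
proof -
  let ?B = "q ` {..<CARD('n)}"
  have "independent ?B"
    by (intro orthonormal_independent orthobasis_orthonormal assms) simp
  moreover have "card ?B = CARD('n)"
    using card_image[OF orthobasis_inj[OF assms]] by simp
  ultimately have "dim ?B = dim (UNIV :: (real^'n) set)"
    by (simp add: dim_eq_card_independent)
  then show ?thesis by (metis dim_eq_full dim_UNIV)
qed

lemma orthobasis_parseval:
  assumes "orthobasis (q :: nat \<Rightarrow> real^'n)"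
  shows "x \<bullet> y = (\<Sum>i<CARD('n). (x \<bullet> q i) * (y \<bullet> q i))"
  using parseval[OF orthobasis_orthonormal[OF assms order_refl] orthobasis_span[OF assms], of x y]
  by (simp add: sum.reindex[OF orthobasis_inj[OF assms]])

lemma orthobasis_parseval_norm:
  assumes "orthobasis (q :: nat \<Rightarrow> real^'n)"
  shows "(\<Sum>i<CARD('n). (x \<bullet> q i)\<^sup>2) = x \<bullet> x"
  using orthobasis_parseval[OF assms, of x x] by (simp add: power2_eq_square)

lemma orthobasis_trace:
  assumes "orthobasis (q :: nat \<Rightarrow> real^'n)"
  shows "trace Y = (\<Sum>i<CARD('n). q i \<bullet> (Y *v q i))"
  using trace_eq_sum_orthonormal[OF orthobasis_orthonormal[OF assms order_refl] orthobasis_span[OF assms], of Y]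
  by (simp add: sum.reindex[OF orthobasis_inj[OF assms]])

lemma spectral_quadratic_form:
  fixes X :: "real^'n^'n"
  assumes X: "X \<in> sym_matrices" and q: "orthobasis q"
    and eig: "\<And>i. i < CARD('n) \<Longrightarrow> X *v q i = L i *\<^sub>R q i"
  shows "v \<bullet> (X *v v) = (\<Sum>i<CARD('n). L i * (v \<bullet> q i)\<^sup>2)"
proof -
  have "v \<bullet> (X *v v) = (\<Sum>i<CARD('n). (v \<bullet> q i) * ((X *v v) \<bullet> q i))"
    by (rule orthobasis_parseval[OF q])
  also have "\<dots> = (\<Sum>i<CARD('n). L i * (v \<bullet> q i)\<^sup>2)"
    using sym_matrix_self_adjoint[OF X, of v, symmetric] eig
    by (intro sum.cong) (auto simp: power2_eq_square)
  finally show ?thesis .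
qed

lemma orthonormal_card_le:
  fixes B :: "(real^'n) set"
  assumes "orthonormal B"
  shows "card B \<le> CARD('n)"
  using independent_card_le[OF orthonormal_independent[OF assms]] by simp

lemma orthonormal_sum_squares:
  fixes B :: "(real^'n) set"
  assumes "orthonormal B" "orthobasis q" "I \<subseteq> {..<CARD('n)}"
  shows "(\<Sum>v\<in>B. \<Sum>i\<in>I. (v \<bullet> q i)\<^sup>2) \<le> real (card B)"
proof -
  have "(\<Sum>v\<in>B. \<Sum>i\<in>I. (v \<bullet> q i)\<^sup>2) \<le> (\<Sum>v\<in>B. \<Sum>i<CARD('n). (v \<bullet> q i)\<^sup>2)"
    by (intro sum_mono sum_mono2) (use assms(3) in auto)
  also have "\<dots> = (\<Sum>v\<in>B. 1)"
    using orthobasis_parseval_norm[OF assms(2)] assms(1)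
    by (intro sum.cong) (auto simp: orthonormal_def norm_eq_1)
  finally show ?thesis by simp
qed

text \<open>
  The weights \<open>w i = \<Sum>v\<in>B. (v \<bullet> q i)\<^sup>2\<close> lie in the unit interval and add up to \<open>card B\<close>, so
  the weighted sum of \<open>M\<close> is largest when all weight sits on the entries above the threshold.
\<close>

lemma ky_fan_bound:
  fixes B :: "(real^'n) set" and M :: "nat \<Rightarrow> real"
  assumes B: "orthonormal B" and q: "orthobasis q"
    and hi: "\<And>i. i < card B \<Longrightarrow> c \<le> M i"
    and lo: "\<And>i. card B \<le> i \<Longrightarrow> i < CARD('n) \<Longrightarrow> M i \<le> c"
  shows "(\<Sum>v\<in>B. \<Sum>i<CARD('n). M i * (v \<bullet> q i)\<^sup>2) \<le> (\<Sum>i<card B. M i)"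
proof -
  define w where "w = (\<lambda>i. \<Sum>v\<in>B. (v \<bullet> q i)\<^sup>2)"
  have l: "card B \<le> CARD('n)" using orthonormal_card_le[OF B] .
  have w0: "w i \<ge> 0" for i by (simp add: w_def sum_nonneg)
  have w1: "w i \<le> 1" if "i < CARD('n)" for i
    using bessel[OF B, of "q i"] orthobasis_inner[OF q that that] by (simp add: w_def inner_commute)
  have wsum: "(\<Sum>i<CARD('n). w i) = real (card B)"
  proof -
    have "(\<Sum>i<CARD('n). w i) = (\<Sum>v\<in>B. \<Sum>i<CARD('n). (v \<bullet> q i)\<^sup>2)"
      unfolding w_def by (rule sum.swap)
    also have "\<dots> = (\<Sum>v\<in>B. 1)"
      using orthobasis_parseval_norm[OF q] B
      by (intro sum.cong) (auto simp: orthonormal_def norm_eq_1)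
    finally show ?thesis by simp
  qed
  have "(\<Sum>v\<in>B. \<Sum>i<CARD('n). M i * (v \<bullet> q i)\<^sup>2) = (\<Sum>i<CARD('n). M i * w i)"
    unfolding w_def sum_distrib_left by (rule sum.swap)
  also have "\<dots> = (\<Sum>i<CARD('n). (M i - c) * w i) + c * real (card B)"
    by (simp add: left_diff_distrib sum_subtractf wsum[symmetric] sum_distrib_left)
  also have "(\<Sum>i<CARD('n). (M i - c) * w i) \<le> (\<Sum>i<CARD('n). if i < card B then M i - c else 0)"
  proof (rule sum_mono)
    fix i assume "i \<in> {..<CARD('n)}"
    then have i: "i < CARD('n)" by simp
    show "(M i - c) * w i \<le> (if i < card B then M i - c else 0)"
      using hi[of i] lo[of i] i w0[of i] w1[OF i]
      by (auto simp: mult_left_le mult_nonpos_nonneg)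
  qed
  also have "(\<Sum>i<CARD('n). if i < card B then M i - c else 0) = (\<Sum>i<card B. M i - c)"
  proof -
    have "{..<CARD('n)} \<inter> {i. i < card B} = {..<card B}" using l by auto
    then show ?thesis by (simp add: sum.If_cases)
  qed
  finally show ?thesis by (simp add: sum_subtractf)
qed

lemma ky_fan_bound_sorted:
  fixes B :: "(real^'n) set" and L :: "nat \<Rightarrow> real"
  assumes B: "orthonormal B" and q: "orthobasis q"
    and L: "\<And>i j. i \<le> j \<Longrightarrow> j < CARD('n) \<Longrightarrow> L j \<le> L i"
  shows "(\<Sum>v\<in>B. \<Sum>i<CARD('n). L i * (v \<bullet> q i)\<^sup>2) \<le> (\<Sum>i<card B. L i)"
proof (cases "card B = 0")
  case True
  then have "B = {}" using orthonormal_finite[OF B] by simp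
  then show ?thesis by simp
next
  case False
  then show ?thesis
    using orthonormal_card_le[OF B]
    by (intro ky_fan_bound[OF B q, of "L (card B - 1)"] L) auto
qed

text \<open>
  On sorted vectors the condition is linear in \<open>(X, x)\<close> for each orthonormal set. This makes
  majorization accessible to convexity, continuity and perturbation arguments.
\<close>

definition ky_fan_dominated :: "real^'n^'n \<Rightarrow> (nat \<Rightarrow> real) \<Rightarrow> bool" where
  "ky_fan_dominated X c \<longleftrightarrow>
     (\<forall>B. orthonormal B \<longrightarrow> (\<Sum>v\<in>B. v \<bullet> (X *v v)) \<le> (\<Sum>i<card B. c i))"

lemma majorizes_eigvals_iff:
  fixes X :: "'n::{finite,linorder} sqmat"
  assumes X: "X \<in> sym_matrices" and x: "nonincreasing x"
  shows "x \<succeq> eigvals X \<longleftrightarrow>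
    ky_fan_dominated X (\<lambda>i. x $ idx i) \<and> (\<Sum>i\<in>UNIV. x $ i) = trace X"
proof -
  obtain q :: "nat \<Rightarrow> real^'n::{finite,linorder}" where e: "nonincreasing (eigvals X)" and
    q: "\<And>i j. i < CARD('n) \<Longrightarrow> j < CARD('n) \<Longrightarrow> q i \<bullet> q j = (if i = j then 1 else 0)"
    and eig: "\<And>i. i < CARD('n) \<Longrightarrow> X *v q i = eigvals X $ idx i *\<^sub>R q i"
    using eigvals_eigenbasis[OF X] by blast
  have ob: "orthobasis q" using q by (simp add: orthobasis_def)
  let ?L = "\<lambda>i. eigvals X $ idx i"
  have tr: "(\<Sum>i\<in>UNIV. eigvals X $ i) = trace X"
    using orthobasis_trace[OF ob, of X] eig q by (simp add: sum_idx)
  have qL: "(\<Sum>v\<in>q ` {..<l}. v \<bullet> (X *v v)) = (\<Sum>i<l. ?L i)" if "l \<le> CARD('n)" for l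
  proof -
    have "inj_on q {..<l}" using orthobasis_inj[OF ob] that by (auto intro: inj_on_subset)
    then show ?thesis using that eig q by (simp add: sum.reindex)
  qed
  have KF: "(\<Sum>v\<in>B. v \<bullet> (X *v v)) \<le> (\<Sum>i<card B. ?L i)" if B: "orthonormal B" for B
  proof -
    have "(\<Sum>v\<in>B. \<Sum>i<CARD('n). ?L i * (v \<bullet> q i)\<^sup>2) \<le> (\<Sum>i<card B. ?L i)"
      using nonincreasing_idx[OF e] by (intro ky_fan_bound_sorted[OF B ob])
    then show ?thesis using spectral_quadratic_form[OF X ob, of ?L] eig by simp
  qed
  have "(\<forall>l\<in>{1..CARD('n)}. sum_largest l (eigvals X) \<le> sum_largest l x) \<longleftrightarrow>
      ky_fan_dominated X (\<lambda>i. x $ idx i)"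
  proof
    assume H: "\<forall>l\<in>{1..CARD('n)}. sum_largest l (eigvals X) \<le> sum_largest l x"
    show "ky_fan_dominated X (\<lambda>i. x $ idx i)"
      unfolding ky_fan_dominated_def
    proof (intro allI impI)
      fix B :: "(real^'n::{finite,linorder}) set" assume B: "orthonormal B"
      have l: "card B \<le> CARD('n)" by (rule orthonormal_card_le[OF B])
      have "(\<Sum>i<card B. ?L i) \<le> (\<Sum>i<card B. x $ idx i)"
      proof (cases "card B = 0")
        case False
        then have "card B \<in> {1..CARD('n)}" using l by simp
        from bspec[OF H this] show ?thesis
          using sum_largest_nonincreasing[OF e l] sum_largest_nonincreasing[OF x l] by simp
      qed simp
      then show "(\<Sum>v\<in>B. v \<bullet> (X *v v)) \<le> (\<Sum>i<card B. x $ idx i)"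
        using KF[OF B] by linarith
    qed
  next
    assume H: "ky_fan_dominated X (\<lambda>i. x $ idx i)"
    show "\<forall>l\<in>{1..CARD('n)}. sum_largest l (eigvals X) \<le> sum_largest l x"
    proof
      fix l assume "l \<in> {1..CARD('n)}"
      then have l: "l \<le> CARD('n)" by simp
      have sub: "{..<l} \<subseteq> {..<CARD('n)}" using l by auto
      have "card (q ` {..<l}) = l"
        using orthobasis_inj[OF ob] sub by (metis card_image card_lessThan inj_on_subset)
      then have "(\<Sum>v\<in>q ` {..<l}. v \<bullet> (X *v v)) \<le> (\<Sum>i<l. x $ idx i)"
        using H orthobasis_orthonormal[OF ob sub] unfolding ky_fan_dominated_def by metis
      then show "sum_largest l (eigvals X) \<le> sum_largest l x"
        using qL[OF l] sum_largest_nonincreasing[OF e l] sum_largest_nonincreasing[OF x l] by simp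
    qed
  qed
  then show ?thesis unfolding majorizes_def using tr by auto
qed

section \<open>Perturbing a positive semidefinite matrix of too large rank\<close>

text \<open>
  The indices, counted from 0, of the eigenvectors that may be mixed when a spectrum with \<open>p\<close>
  positive entries is dominated by a vector supported on the first \<open>u < p\<close> positions. The last index
  \<open>u - 1\<close> inside the support belongs to the block, since mixing it with the later ones only affects
  partial sums that have slack or that are controlled by the trace.
\<close>

definition excess_block :: "nat \<Rightarrow> nat \<Rightarrow> nat set" where
  "excess_block u p = (if p \<le> u then {} else {u - 1..<p})"

text \<open>
  One sign of the problem: \<open>L\<close> is the spectrum of a positive semidefinite matrix with eigenvectors
  \<open>q\<close>, and \<open>c\<close> is the corresponding part of the witness. The totals of \<open>L\<close> and \<open>c\<close> may differ, because
  taking positive parts destroys the equality of the traces.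
\<close>

locale dominated_spectrum =
  fixes q :: "nat \<Rightarrow> real^'n" and L c :: "nat \<Rightarrow> real" and u p :: nat
  assumes q: "orthobasis q"
    and L_sorted: "\<And>i j. i \<le> j \<Longrightarrow> j < CARD('n) \<Longrightarrow> L j \<le> L i"
    and L_nonneg: "\<And>i. i < CARD('n) \<Longrightarrow> L i \<ge> 0"
    and L_pos_iff: "\<And>i. i < CARD('n) \<Longrightarrow> L i > 0 \<longleftrightarrow> i < p"
    and p_le: "p \<le> CARD('n)"
    and c_sorted: "\<And>i j. i \<le> j \<Longrightarrow> j < CARD('n) \<Longrightarrow> c j \<le> c i"
    and c_nonneg: "\<And>i. i < CARD('n) \<Longrightarrow> c i \<ge> 0"
    and c_zero: "\<And>i. u \<le> i \<Longrightarrow> i < CARD('n) \<Longrightarrow> c i = 0"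
    and dom: "\<And>l. l \<le> CARD('n) \<Longrightarrow> (\<Sum>i<l. L i) \<le> (\<Sum>i<l. c i)"
begin

lemma sum_L_less:
  assumes "l < p"
  shows "(\<Sum>i<l. L i) < (\<Sum>i<p. L i)"
proof (rule sum_strict_mono2)
  show "{..<l} \<subseteq> {..<p}" using assms by auto
  show "l \<in> {..<p} - {..<l}" "0 < L l" using assms L_pos_iff[of l] p_le by auto
  show "\<And>i. i \<in> {..<p} \<Longrightarrow> 0 \<le> L i" using L_nonneg p_le by auto
qed simp

lemma sum_c_const:
  assumes "u \<le> l" "l \<le> p"
  shows "(\<Sum>i<l. c i) = (\<Sum>i<p. c i)"
proof (rule sum.mono_neutral_left)
  show "{..<l} \<subseteq> {..<p}" using assms by auto
  show "\<forall>i\<in>{..<p} - {..<l}. c i = 0" using assms c_zero p_le by auto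
qed simp

text \<open>
  Up to \<open>p\<close> the sums of \<open>L\<close> still increase, those of \<open>c\<close> have reached their final value.
\<close>

lemma strict_beyond_support:
  assumes "u \<le> l" "l < p"
  shows "(\<Sum>i<l. L i) < (\<Sum>i<l. c i)"
proof -
  have "(\<Sum>i<l. L i) < (\<Sum>i<p. L i)" by (rule sum_L_less[OF assms(2)])
  also have "\<dots> \<le> (\<Sum>i<p. c i)" by (rule dom[OF p_le])
  also have "\<dots> = (\<Sum>i<l. c i)" using sum_c_const[of l] assms by simp
  finally show ?thesis .
qed

lemma excess_imp_support_nonempty:
  assumes "u < p"
  shows "u \<ge> 1"
proof (rule ccontr)
  assume "\<not> u \<ge> 1"
  then have "(\<Sum>i<0. L i) < (\<Sum>i<0. c i)"
    by (intro strict_beyond_support) (use assms in auto)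
  then show False by simp
qed

text \<open>
  A tie \<open>L (l - 1) = L (u - 1)\<close> would extend equality of the partial sums from \<open>l\<close> to \<open>u\<close>:
  along the tie the sums of \<open>L\<close> grow linearly, those of \<open>c\<close> are concave.
\<close>

lemma tight_imp_gap:
  assumes up: "u < p" and l: "1 \<le> l" "l < p" and eq: "(\<Sum>i<l. L i) = (\<Sum>i<l. c i)"
  shows "l < u \<and> L (u - 1) < L (l - 1)"
proof -
  have lu: "l < u" using strict_beyond_support[of l] l eq by (cases "u \<le> l") auto
  moreover have "L (u - 1) < L (l - 1)"
  proof (rule ccontr)
    assume "\<not> L (u - 1) < L (l - 1)"
    then have tie: "L (l - 1) \<le> L (u - 1)" by simp
    obtain l' where l': "l = Suc l'" using l by (cases l) auto
    have ln: "l \<le> CARD('n)" "u \<le> CARD('n)" using l up p_le by auto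
    have "(\<Sum>i<l'. L i) \<le> (\<Sum>i<l'. c i)" using dom[of l'] ln l' by simp
    then have cL: "c l' \<le> L l'" using eq l' by simp
    have split: "(\<Sum>i<u. g i) = (\<Sum>i<l. g i) + (\<Sum>i=l..<u. g i)" for g :: "nat \<Rightarrow> real"
      using lu by (metis atLeast0LessThan le_eq_less_or_eq sum.atLeastLessThan_concat zero_le)
    have "(\<Sum>i=l..<u. c i) \<le> (\<Sum>i=l..<u. L i)"
    proof (rule sum_mono)
      fix i assume i: "i \<in> {l..<u}"
      have "c i \<le> c l'" using i l' ln by (intro c_sorted) auto
      also have "\<dots> \<le> L l'" by (rule cL)
      also have "\<dots> \<le> L (u - 1)" using tie l' by simp
      also have "\<dots> \<le> L i" using i ln by (intro L_sorted) auto
      finally show "c i \<le> L i" .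
    qed
    then have "(\<Sum>i<u. c i) \<le> (\<Sum>i<u. L i)" using split[of c] split[of L] eq by simp
    then show False using strict_beyond_support[of u] up by simp
  qed
  ultimately show ?thesis by simp
qed

lemma quadratic_form_sum_le:
  fixes D :: "real^'n^'n"
  assumes "\<And>v. \<bar>v \<bullet> (D *v v)\<bar> \<le> \<epsilon> * (\<Sum>i\<in>I. (v \<bullet> q i)\<^sup>2)"
    and "I \<subseteq> {..<CARD('n)}" "orthonormal B" "\<epsilon> \<ge> 0"
  shows "(\<Sum>v\<in>B. v \<bullet> (D *v v)) \<le> \<epsilon> * real (card B)"
proof -
  have "(\<Sum>v\<in>B. v \<bullet> (D *v v)) \<le> (\<Sum>v\<in>B. \<epsilon> * (\<Sum>i\<in>I. (v \<bullet> q i)\<^sup>2))"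
    by (intro sum_mono order_trans[OF abs_ge_self assms(1)])
  also have "\<dots> = \<epsilon> * (\<Sum>v\<in>B. \<Sum>i\<in>I. (v \<bullet> q i)\<^sup>2)" by (simp add: sum_distrib_left)
  also have "\<dots> \<le> \<epsilon> * real (card B)"
    by (intro mult_left_mono orthonormal_sum_squares q assms)
  finally show ?thesis .
qed

lemma excess_block_subset: "excess_block u p \<subseteq> {..<CARD('n)}"
  using p_le by (auto simp: excess_block_def)

text \<open>
  Each partial sum has its own reason to tolerate small perturbations and its own threshold. Stating
  the tolerance separately for each \<open>l\<close> lets a filter combine the finitely many thresholds.
\<close>

definition stays_dominated :: "nat \<Rightarrow> real \<Rightarrow> bool" where
  "stays_dominated l \<epsilon> \<longleftrightarrow> (\<forall>D :: real^'n^'n. \<forall>B.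
     (\<forall>v. \<bar>v \<bullet> (D *v v)\<bar> \<le> \<epsilon> * (\<Sum>i\<in>excess_block u p. (v \<bullet> q i)\<^sup>2)) \<longrightarrow>
     trace D = 0 \<longrightarrow> orthonormal B \<longrightarrow> card B = l \<longrightarrow>
     (\<Sum>v\<in>B. (\<Sum>i<CARD('n). L i * (v \<bullet> q i)\<^sup>2) + v \<bullet> (D *v v)) \<le> (\<Sum>i<l. c i))"

text \<open>All eigenvalues that the perturbation touches are at least \<open>L (p - 1) > 0\<close>.\<close>

lemma perturbed_form_nonneg:
  fixes D :: "real^'n^'n"
  assumes \<epsilon>: "u < p \<Longrightarrow> \<epsilon> < L (p - 1)"
    and D: "\<bar>v \<bullet> (D *v v)\<bar> \<le> \<epsilon> * (\<Sum>i\<in>excess_block u p. (v \<bullet> q i)\<^sup>2)"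
  shows "(\<Sum>i<CARD('n). L i * (v \<bullet> q i)\<^sup>2) + v \<bullet> (D *v v) \<ge> 0"
proof -
  have "\<epsilon> * (\<Sum>i\<in>excess_block u p. (v \<bullet> q i)\<^sup>2) \<le> (\<Sum>i\<in>excess_block u p. L i * (v \<bullet> q i)\<^sup>2)"
    unfolding sum_distrib_left
  proof (intro sum_mono mult_right_mono)
    fix i assume i: "i \<in> excess_block u p"
    then have "u < p" "i \<le> p - 1" by (auto simp: excess_block_def split: if_splits)
    moreover have "p - 1 < CARD('n)" using \<open>u < p\<close> p_le by simp
    ultimately show "\<epsilon> \<le> L i" using L_sorted[of i "p - 1"] \<epsilon> by simp
  qed simp
  also have "\<dots> \<le> (\<Sum>i<CARD('n). L i * (v \<bullet> q i)\<^sup>2)"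
    by (intro sum_mono2 excess_block_subset) (auto simp: L_nonneg)
  finally show ?thesis using D by simp
qed

text \<open>
  Beyond the rank the perturbed matrix, still positive semidefinite, has no partial trace above
  its trace, which is unchanged.
\<close>

lemma stays_dominated_beyond_rank:
  assumes "u < p" "p \<le> l" "l \<le> CARD('n)"
  shows "\<forall>\<^sub>F \<epsilon> in at_right 0. stays_dominated l \<epsilon>"
proof -
  have p: "1 \<le> p" "p - 1 < CARD('n)" using assms by auto
  have pos: "0 < L (p - 1)" using L_pos_iff[of "p - 1"] p by auto
  have "stays_dominated l \<epsilon>" if \<epsilon>: "0 < \<epsilon>" "\<epsilon> < L (p - 1)" for \<epsilon>
    unfolding stays_dominated_def
  proof (intro allI impI)
    fix D :: "real^'n^'n" and B :: "(real^'n) set"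
    assume D: "\<forall>v. \<bar>v \<bullet> (D *v v)\<bar> \<le> \<epsilon> * (\<Sum>i\<in>excess_block u p. (v \<bullet> q i)\<^sup>2)"
      and tr: "trace D = 0" and B: "orthonormal B" and l: "card B = l"
    define Q where "Q = (\<lambda>v. (\<Sum>i<CARD('n). L i * (v \<bullet> q i)\<^sup>2) + v \<bullet> (D *v v))"
    have Q: "Q v \<ge> 0" for v
      using perturbed_form_nonneg[of \<epsilon> v D] D \<epsilon> by (simp add: Q_def)
    obtain C where C: "B \<subseteq> C" "orthonormal C" "span C = UNIV"
      using orthonormal_extend_to_basis[OF B] .
    have "(\<Sum>v\<in>B. Q v) \<le> (\<Sum>v\<in>C. Q v)"
      using C Q orthonormal_finite by (intro sum_mono2) auto
    also have "(\<Sum>v\<in>C. Q v) = (\<Sum>v\<in>C. \<Sum>i<CARD('n). L i * (v \<bullet> q i)\<^sup>2) + trace D"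
      unfolding Q_def by (simp add: sum.distrib trace_eq_sum_orthonormal[OF C(2,3)])
    also have "(\<Sum>v\<in>C. \<Sum>i<CARD('n). L i * (v \<bullet> q i)\<^sup>2) = (\<Sum>i<CARD('n). L i * (\<Sum>v\<in>C. (v \<bullet> q i)\<^sup>2))"
      by (subst sum.swap) (simp add: sum_distrib_left)
    also have "\<dots> = (\<Sum>i<CARD('n). L i)"
    proof (rule sum.cong)
      fix i assume "i \<in> {..<CARD('n)}"
      then have "q i \<bullet> q i = 1" using orthobasis_inner[OF q, of i i] by simp
      then have "(\<Sum>v\<in>C. (v \<bullet> q i)\<^sup>2) = 1"
        using parseval[OF C(2,3), of "q i" "q i"] by (simp add: power2_eq_square inner_commute)
      then show "L i * (\<Sum>v\<in>C. (v \<bullet> q i)\<^sup>2) = L i" by simp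
    qed simp
    also have "\<dots> = (\<Sum>i<p. L i)"
    proof (rule sum.mono_neutral_right)
      show "{..<p} \<subseteq> {..<CARD('n)}" using p_le by auto
      show "\<forall>i\<in>{..<CARD('n)} - {..<p}. L i = 0"
        using L_pos_iff L_nonneg by (auto intro: antisym simp: not_less[symmetric])
    qed simp
    also have "\<dots> \<le> (\<Sum>i<p. c i)" by (rule dom[OF p_le])
    also have "\<dots> \<le> (\<Sum>i<l. c i)"
      using assms c_nonneg by (intro sum_mono2) auto
    finally show "(\<Sum>v\<in>B. (\<Sum>i<CARD('n). L i * (v \<bullet> q i)\<^sup>2) + v \<bullet> (D *v v)) \<le> (\<Sum>i<l. c i)"
      using tr by (simp add: Q_def)
  qed
  then show ?thesis using pos by (auto simp: eventually_at_right[OF pos])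
qed

lemma stays_dominated_slack:
  assumes "l \<le> CARD('n)" "(\<Sum>i<l. L i) < (\<Sum>i<l. c i)"
  shows "\<forall>\<^sub>F \<epsilon> in at_right 0. stays_dominated l \<epsilon>"
proof -
  define d where "d = ((\<Sum>i<l. c i) - (\<Sum>i<l. L i)) / CARD('n)"
  have d: "d > 0" using assms(2) by (simp add: d_def)
  have "stays_dominated l \<epsilon>" if \<epsilon>: "0 < \<epsilon>" "\<epsilon> < d" for \<epsilon>
    unfolding stays_dominated_def
  proof (intro allI impI)
    fix D :: "real^'n^'n" and B :: "(real^'n) set"
    assume D: "\<forall>v. \<bar>v \<bullet> (D *v v)\<bar> \<le> \<epsilon> * (\<Sum>i\<in>excess_block u p. (v \<bullet> q i)\<^sup>2)"
      and B: "orthonormal B" and l: "card B = l"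
    have "(\<Sum>v\<in>B. v \<bullet> (D *v v)) \<le> \<epsilon> * real (card B)"
      using quadratic_form_sum_le[OF _ excess_block_subset B] D \<epsilon> by auto
    also have "\<dots> \<le> d * CARD('n)"
      using \<epsilon> assms(1) l by (intro mult_mono) auto
    finally have "(\<Sum>v\<in>B. v \<bullet> (D *v v)) \<le> (\<Sum>i<l. c i) - (\<Sum>i<l. L i)" by (simp add: d_def)
    moreover have "(\<Sum>v\<in>B. \<Sum>i<CARD('n). L i * (v \<bullet> q i)\<^sup>2) \<le> (\<Sum>i<l. L i)"
      using ky_fan_bound_sorted[OF B q L_sorted] l by simp
    ultimately show "(\<Sum>v\<in>B. (\<Sum>i<CARD('n). L i * (v \<bullet> q i)\<^sup>2) + v \<bullet> (D *v v)) \<le> (\<Sum>i<l. c i)"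
      by (simp add: sum.distrib)
  qed
  then show ?thesis using d by (auto simp: eventually_at_right[OF d])
qed

text \<open>
  Across a spectral gap the perturbation of the lower eigenvalues cannot reach the top \<open>l\<close> ones.
\<close>

lemma stays_dominated_gap:
  assumes "1 \<le> l" "l < u" "u < p" "L (u - 1) < L (l - 1)"
  shows "\<forall>\<^sub>F \<epsilon> in at_right 0. stays_dominated l \<epsilon>"
proof -
  define d where "d = L (l - 1) - L (u - 1)"
  have d: "d > 0" using assms(4) by (simp add: d_def)
  have "stays_dominated l \<epsilon>" if \<epsilon>: "0 < \<epsilon>" "\<epsilon> < d" for \<epsilon>
    unfolding stays_dominated_def
  proof (intro allI impI)
    fix D :: "real^'n^'n" and B :: "(real^'n) set"
    assume D: "\<forall>v. \<bar>v \<bullet> (D *v v)\<bar> \<le> \<epsilon> * (\<Sum>i\<in>excess_block u p. (v \<bullet> q i)\<^sup>2)"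
      and B: "orthonormal B" and l: "card B = l"
    \<comment> \<open>in every quadratic form the perturbation is at most \<open>\<epsilon>\<close> times the block projection\<close>
    define M where "M = (\<lambda>i. L i + (if i \<in> excess_block u p then \<epsilon> else 0))"
    have blk: "i \<in> excess_block u p \<longleftrightarrow> u - 1 \<le> i \<and> i < p" for i
      using assms(3) by (auto simp: excess_block_def)
    have "(\<Sum>i<CARD('n). L i * (v \<bullet> q i)\<^sup>2) + v \<bullet> (D *v v) \<le> (\<Sum>i<CARD('n). M i * (v \<bullet> q i)\<^sup>2)" for v
    proof -
      have "(\<Sum>i<CARD('n). (if i \<in> excess_block u p then \<epsilon> else 0) * (v \<bullet> q i)\<^sup>2) =
          (\<Sum>i\<in>excess_block u p. \<epsilon> * (v \<bullet> q i)\<^sup>2)"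
        using excess_block_subset
        by (intro sum.mono_neutral_cong_right) auto
      then show ?thesis
        using D[rule_format, of v] by (simp add: M_def distrib_right sum.distrib sum_distrib_left)
    qed
    then have "(\<Sum>v\<in>B. (\<Sum>i<CARD('n). L i * (v \<bullet> q i)\<^sup>2) + v \<bullet> (D *v v)) \<le>
        (\<Sum>v\<in>B. \<Sum>i<CARD('n). M i * (v \<bullet> q i)\<^sup>2)"
      by (rule sum_mono)
    also have "\<dots> \<le> (\<Sum>i<card B. M i)"
    proof (rule ky_fan_bound[OF B q, of "L (l - 1)"])
      fix i assume "i < card B"
      then have "L (l - 1) \<le> L i" using l assms p_le by (intro L_sorted) auto
      then show "L (l - 1) \<le> M i" using \<epsilon> by (simp add: M_def)
    next
      fix i assume i: "card B \<le> i" "i < CARD('n)"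
      show "M i \<le> L (l - 1)"
      proof (cases "i \<in> excess_block u p")
        case True
        then have "L i \<le> L (u - 1)" using i by (intro L_sorted) (auto simp: blk)
        then show ?thesis using True \<epsilon> by (simp add: M_def d_def)
      next
        case False
        then show ?thesis using i l by (auto simp: M_def intro!: L_sorted)
      qed
    qed
    also have "(\<Sum>i<card B. M i) = (\<Sum>i<l. L i)"
      using l assms(2) by (intro sum.cong) (auto simp: M_def blk)
    also have "\<dots> \<le> (\<Sum>i<l. c i)" using assms p_le by (intro dom) simp
    finally show "(\<Sum>v\<in>B. (\<Sum>i<CARD('n). L i * (v \<bullet> q i)\<^sup>2) + v \<bullet> (D *v v)) \<le> (\<Sum>i<l. c i)" .
  qed
  then show ?thesis using d by (auto simp: eventually_at_right[OF d])
qed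

lemma stays_dominated_no_excess:
  assumes "p \<le> u" "l \<le> CARD('n)"
  shows "stays_dominated l \<epsilon>"
  unfolding stays_dominated_def
proof (intro allI impI)
  fix D :: "real^'n^'n" and B :: "(real^'n) set"
  assume "\<forall>v. \<bar>v \<bullet> (D *v v)\<bar> \<le> \<epsilon> * (\<Sum>i\<in>excess_block u p. (v \<bullet> q i)\<^sup>2)"
    and B: "orthonormal B" and l: "card B = l"
  then have "v \<bullet> (D *v v) = 0" for v using assms(1) by (simp add: excess_block_def)
  moreover have "(\<Sum>v\<in>B. \<Sum>i<CARD('n). L i * (v \<bullet> q i)\<^sup>2) \<le> (\<Sum>i<l. L i)"
    using ky_fan_bound_sorted[OF B q L_sorted] l by simp
  ultimately show "(\<Sum>v\<in>B. (\<Sum>i<CARD('n). L i * (v \<bullet> q i)\<^sup>2) + v \<bullet> (D *v v)) \<le> (\<Sum>i<l. c i)"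
    using dom[OF assms(2)] by simp
qed

lemma eventually_stays_dominated:
  assumes "l \<le> CARD('n)"
  shows "\<forall>\<^sub>F \<epsilon> in at_right 0. stays_dominated l \<epsilon>"
proof -
  consider "p \<le> u" | "u < p" "p \<le> l" | "u < p" "l < p" "(\<Sum>i<l. L i) < (\<Sum>i<l. c i)"
    | "l = 0" | "u < p" "1 \<le> l" "l < p" "(\<Sum>i<l. L i) = (\<Sum>i<l. c i)"
    using dom[OF assms] by (cases "l = 0") fastforce+
  then show ?thesis
  proof cases
    case 1
    then show ?thesis using stays_dominated_no_excess assms by simp
  next
    case 2
    then show ?thesis using stays_dominated_beyond_rank assms by simp
  next
    case 3
    then show ?thesis using stays_dominated_slack assms by simp
  next
    case 4
    then have "stays_dominated l \<epsilon>" for \<epsilon>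
      using orthonormal_finite by (fastforce simp: stays_dominated_def)
    then show ?thesis by simp
  next
    case 5
    then show ?thesis using stays_dominated_gap tight_imp_gap by blast
  qed
qed

lemma perturbation_dominated:
  obtains \<epsilon> where "\<epsilon> > 0"
    "\<And>(D :: real^'n^'n) v. \<bar>v \<bullet> (D *v v)\<bar> \<le> \<epsilon> * (\<Sum>i\<in>excess_block u p. (v \<bullet> q i)\<^sup>2) \<Longrightarrow>
      (\<Sum>i<CARD('n). L i * (v \<bullet> q i)\<^sup>2) + v \<bullet> (D *v v) \<ge> 0"
    "\<And>(D :: real^'n^'n) B. \<lbrakk>\<And>v. \<bar>v \<bullet> (D *v v)\<bar> \<le> \<epsilon> * (\<Sum>i\<in>excess_block u p. (v \<bullet> q i)\<^sup>2);
      trace D = 0; orthonormal B\<rbrakk> \<Longrightarrow>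
      (\<Sum>v\<in>B. (\<Sum>i<CARD('n). L i * (v \<bullet> q i)\<^sup>2) + v \<bullet> (D *v v)) \<le> (\<Sum>i<card B. c i)"
proof -
  have "\<forall>\<^sub>F \<epsilon> in at_right (0::real). \<forall>l\<in>{..CARD('n)}. stays_dominated l \<epsilon>"
    by (intro eventually_ball_finite) (auto intro: eventually_stays_dominated)
  moreover have "\<forall>\<^sub>F \<epsilon> in at_right (0::real). u < p \<longrightarrow> \<epsilon> < L (p - 1)"
  proof (cases "u < p")
    case True
    then have "0 < L (p - 1)" using L_pos_iff[of "p - 1"] p_le by auto
    from eventually_at_right_real[OF this] show ?thesis by eventually_elim simp
  qed simp
  ultimately have "\<forall>\<^sub>F \<epsilon> in at_right (0::real). 0 < \<epsilon> \<and> (u < p \<longrightarrow> \<epsilon> < L (p - 1)) \<and>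
      (\<forall>l\<in>{..CARD('n)}. stays_dominated l \<epsilon>)"
    using eventually_at_right_less[of "0::real"] by eventually_elim auto
  then obtain \<epsilon> where \<epsilon>: "0 < \<epsilon>" "u < p \<Longrightarrow> \<epsilon> < L (p - 1)" "\<forall>l\<in>{..CARD('n)}. stays_dominated l \<epsilon>"
    using eventually_happens'[of "at_right (0::real)"] by force
  show ?thesis
  proof (rule that[OF \<epsilon>(1)])
    fix D :: "real^'n^'n" and B :: "(real^'n) set"
    assume *: "\<And>v. \<bar>v \<bullet> (D *v v)\<bar> \<le> \<epsilon> * (\<Sum>i\<in>excess_block u p. (v \<bullet> q i)\<^sup>2)"
      "trace D = 0" "orthonormal B"
    then have "stays_dominated (card B) \<epsilon>" using \<epsilon>(3) orthonormal_card_le by auto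
    then show "(\<Sum>v\<in>B. (\<Sum>i<CARD('n). L i * (v \<bullet> q i)\<^sup>2) + v \<bullet> (D *v v)) \<le> (\<Sum>i<card B. c i)"
      using * unfolding stays_dominated_def by blast
  qed (use perturbed_form_nonneg \<epsilon>(2) in blast)
qed

end

section \<open>Splitting a symmetric matrix into its positive and negative parts\<close>

lemma downward_closed_eq_lessThan:
  assumes "finite A" "\<And>i j. j \<in> A \<Longrightarrow> i \<le> j \<Longrightarrow> i \<in> A"
  shows "A = {..<card A :: nat}"
proof (cases "A = {}")
  case False
  have "A = {..Max A}"
    using assms(2)[OF Max_in[OF assms(1) False]] Max_ge[OF assms(1)] by blast
  then have "A = {..<Suc (Max A)}" by (simp add: lessThan_Suc_atMost)
  then show ?thesis by (metis card_lessThan)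
qed simp

lemma dominated_spectrum_positive_part:
  fixes q :: "nat \<Rightarrow> real^'n" and L a :: "nat \<Rightarrow> real"
  assumes q: "orthobasis q"
    and L: "\<And>i j. i \<le> j \<Longrightarrow> j < CARD('n) \<Longrightarrow> L j \<le> L i"
    and a: "\<And>i j. i \<le> j \<Longrightarrow> j < CARD('n) \<Longrightarrow> a j \<le> a i"
    and a_nonpos: "\<And>i. u \<le> i \<Longrightarrow> i < CARD('n) \<Longrightarrow> a i \<le> 0"
    and dom: "\<And>l. l \<le> CARD('n) \<Longrightarrow> (\<Sum>i<l. L i) \<le> (\<Sum>i<l. a i)"
  shows "dominated_spectrum q (\<lambda>i. max 0 (L i)) (\<lambda>i. max 0 (a i)) u (card {i. i < CARD('n) \<and> L i > 0})"
proof -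
  let ?p = "card {i. i < CARD('n) \<and> L i > 0}"
  have P: "{i. i < CARD('n) \<and> L i > 0} = {..<?p}"
    using L by (intro downward_closed_eq_lessThan) (auto intro: less_le_trans)
  have p_le: "?p \<le> CARD('n)"
    using card_mono[of "{..<CARD('n)}" "{i. i < CARD('n) \<and> L i > 0}"] by auto
  have pos_iff: "L i > 0 \<longleftrightarrow> i < ?p" if "i < CARD('n)" for i
    using P that by blast
  show ?thesis
  proof
    fix l assume l: "l \<le> CARD('n)"
    have "(\<Sum>i<l. max 0 (L i)) = (\<Sum>i<min l ?p. L i)"
    proof (rule sum.mono_neutral_cong_right)
      show "\<forall>i\<in>{..<l} - {..<min l ?p}. max 0 (L i) = 0"
        using pos_iff l by (auto simp: not_less[symmetric])
      show "max 0 (L i) = L i" if "i \<in> {..<min l ?p}" for i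
        using pos_iff[of i] that l by simp
    qed auto
    also have "\<dots> \<le> (\<Sum>i<min l ?p. a i)" using l by (intro dom) simp
    also have "\<dots> \<le> (\<Sum>i<min l ?p. max 0 (a i))" by (intro sum_mono) simp
    also have "\<dots> \<le> (\<Sum>i<l. max 0 (a i))" by (intro sum_mono2) auto
    finally show "(\<Sum>i<l. max 0 (L i)) \<le> (\<Sum>i<l. max 0 (a i))" .
  next
    show "\<And>i. i < CARD('n) \<Longrightarrow> (0 < max 0 (L i)) = (i < ?p)"
      using pos_iff by (simp add: less_max_iff_disj)
    show "\<And>i j. i \<le> j \<Longrightarrow> j < CARD('n) \<Longrightarrow> max 0 (L j) \<le> max 0 (L i)"
      using L by (meson max.mono order_refl)
    show "\<And>i j. i \<le> j \<Longrightarrow> j < CARD('n) \<Longrightarrow> max 0 (a j) \<le> max 0 (a i)"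
      using a by (meson max.mono order_refl)
    show "\<And>i. u \<le> i \<Longrightarrow> i < CARD('n) \<Longrightarrow> max 0 (a i) = 0"
      using a_nonpos by (simp add: max_absorb1)
  qed (use q p_le in auto)
qed

text \<open>Passing from a matrix to its negative reverses the sorted spectrum.\<close>

lemma sum_reversed_prefix:
  fixes g :: "nat \<Rightarrow> real"
  assumes "l \<le> n"
  shows "(\<Sum>i<l. g (n - 1 - i)) = (\<Sum>i<n. g i) - (\<Sum>i<n - l. g i)"
  using assms
proof (induction l)
  case (Suc l)
  have "n - l = Suc (n - Suc l)" using Suc.prems by simp
  then have "(\<Sum>i<n - l. g i) = (\<Sum>i<n - Suc l. g i) + g (n - 1 - l)"
    by (metis diff_Suc_eq_diff_pred sum.lessThan_Suc)
  then show ?case using Suc by simp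
qed simp

lemma orthobasis_reverse:
  assumes "orthobasis (q :: nat \<Rightarrow> real^'n)"
  shows "orthobasis (\<lambda>i. q (CARD('n) - 1 - i))"
  unfolding orthobasis_def
proof (intro allI impI)
  fix i j assume "i < CARD('n)" "j < CARD('n)"
  then show "q (CARD('n) - 1 - i) \<bullet> q (CARD('n) - 1 - j) = (if i = j then 1 else 0)"
    using orthobasis_inner[OF assms, of "CARD('n) - 1 - i" "CARD('n) - 1 - j"] by auto
qed

text \<open>
  The witness vector \<open>a\<close> is nonnegative up to \<open>h\<close> and nonpositive from \<open>u \<le> h\<close> on. Majorization
  of the spectrum then splits into domination of the positive part, which controls the sums of
  up to \<open>h\<close> largest eigenvalues, and of the negative part, which controls the remaining ones
  through the trace. Perturbations of the two parts are independent of each other.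
\<close>

lemma dominated_of_parts:
  fixes q :: "nat \<Rightarrow> real^'n" and L a :: "nat \<Rightarrow> real" and X D1 D2 :: "real^'n^'n"
  defines "n \<equiv> CARD('n)"
  defines "Q1 \<equiv> \<lambda>v. (\<Sum>i<n. max 0 (L i) * (v \<bullet> q i)\<^sup>2) + v \<bullet> (D1 *v v)"
    and "Q2 \<equiv> \<lambda>v. (\<Sum>i<n. max 0 (- L (n - 1 - i)) * (v \<bullet> q (n - 1 - i))\<^sup>2) - v \<bullet> (D2 *v v)"
  assumes X: "\<And>v. v \<bullet> (X *v v) = (\<Sum>i<n. L i * (v \<bullet> q i)\<^sup>2)"
    and tr: "trace X = (\<Sum>i<n. a i)" "trace D1 = 0" "trace D2 = 0"
    and uh: "u \<le> h" "h \<le> n"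
    and a_nonneg: "\<And>i. i < h \<Longrightarrow> a i \<ge> 0" and a_nonpos: "\<And>i. u \<le> i \<Longrightarrow> i < n \<Longrightarrow> a i \<le> 0"
    and Q1: "\<And>v. Q1 v \<ge> 0" and Q2: "\<And>v. Q2 v \<ge> 0"
    and Q1_dom: "\<And>B. orthonormal B \<Longrightarrow> (\<Sum>v\<in>B. Q1 v) \<le> (\<Sum>i<card B. max 0 (a i))"
    and Q2_dom: "\<And>B. orthonormal B \<Longrightarrow> (\<Sum>v\<in>B. Q2 v) \<le> (\<Sum>i<card B. max 0 (- a (n - 1 - i)))"
  shows "ky_fan_dominated (X + (D1 + D2)) a"
  unfolding ky_fan_dominated_def
proof (intro allI impI)
  fix B :: "(real^'n) set" assume B: "orthonormal B"
  let ?Y = "X + (D1 + D2)"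
  have l: "card B \<le> n" using orthonormal_card_le[OF B] by (simp add: n_def)
  have Y: "v \<bullet> (?Y *v v) = Q1 v - Q2 v" for v
  proof -
    have "(\<Sum>i<n. max 0 (- L (n - 1 - i)) * (v \<bullet> q (n - 1 - i))\<^sup>2) =
        (\<Sum>i<n. max 0 (- L i) * (v \<bullet> q i)\<^sup>2)"
      using sum_reversed_prefix[of n n "\<lambda>i. max 0 (- L i) * (v \<bullet> q i)\<^sup>2"] by simp
    moreover have "(\<Sum>i<n. L i * (v \<bullet> q i)\<^sup>2) =
       (\<Sum>i<n. max 0 (L i) * (v \<bullet> q i)\<^sup>2) - (\<Sum>i<n. max 0 (- L i) * (v \<bullet> q i)\<^sup>2)"
      unfolding sum_subtractf[symmetric] by (intro sum.cong) (auto simp: max_def)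
    ultimately show ?thesis
      by (simp add: Q1_def Q2_def X matrix_vector_mult_add_rdistrib inner_add_right)
  qed
  show "(\<Sum>v\<in>B. v \<bullet> (?Y *v v)) \<le> (\<Sum>i<card B. a i)"
  proof (cases "card B \<le> h")
    case True
    have "(\<Sum>v\<in>B. v \<bullet> (?Y *v v)) \<le> (\<Sum>v\<in>B. Q1 v)"
      using Q2 by (intro sum_mono) (simp add: Y)
    also have "\<dots> \<le> (\<Sum>i<card B. max 0 (a i))" by (rule Q1_dom[OF B])
    also have "\<dots> = (\<Sum>i<card B. a i)"
      using True a_nonneg by (intro sum.cong) (auto simp: max_def)
    finally show ?thesis .
  next
    case False
    obtain C where C: "B \<subseteq> C" "orthonormal C" "span C = UNIV"
      using orthonormal_extend_to_basis[OF B] .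
    have finC: "finite C" by (rule orthonormal_finite[OF C(2)])
    have "card C = n"
      using dim_eq_card_independent[OF orthonormal_independent[OF C(2)]] dim_span[of C] C(3)
      by (simp add: n_def)
    then have cardCB: "card (C - B) = n - card B"
      using C(1) finC by (simp add: card_Diff_subset finite_subset)
    have CB: "orthonormal (C - B)"
      using C(2) unfolding orthonormal_def by (auto intro: pairwise_subset)
    have "trace ?Y = (\<Sum>v\<in>C. v \<bullet> (?Y *v v))" by (rule trace_eq_sum_orthonormal[OF C(2,3)])
    also have "\<dots> = (\<Sum>v\<in>C - B. v \<bullet> (?Y *v v)) + (\<Sum>v\<in>B. v \<bullet> (?Y *v v))"
      by (rule sum.subset_diff[OF C(1) finC])
    finally have "(\<Sum>v\<in>B. v \<bullet> (?Y *v v)) = trace ?Y + (\<Sum>v\<in>C - B. Q2 v - Q1 v)"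
      by (simp add: Y sum_subtractf)
    also have "(\<Sum>v\<in>C - B. Q2 v - Q1 v) \<le> (\<Sum>v\<in>C - B. Q2 v)"
      using Q1 by (intro sum_mono) simp
    also have "\<dots> \<le> (\<Sum>i<n - card B. max 0 (- a (n - 1 - i)))"
      using Q2_dom[OF CB] cardCB by simp
    also have "\<dots> = (\<Sum>i<n - card B. - a (n - 1 - i))"
    proof (rule sum.cong)
      fix i assume i: "i \<in> {..<n - card B}"
      have "a (n - 1 - i) \<le> 0" using i False uh by (intro a_nonpos) auto
      then show "max 0 (- a (n - 1 - i)) = - a (n - 1 - i)" by simp
    qed simp
    also have "\<dots> = - ((\<Sum>i<n. a i) - (\<Sum>i<card B. a i))"
      using sum_reversed_prefix[of "n - card B" n a] l by (simp add: sum_negf)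
    also have "trace ?Y = (\<Sum>i<n. a i)" using tr by (simp add: trace_add)
    finally show ?thesis by simp
  qed
qed

section \<open>Counting the traceless block perturbations\<close>

definition outer :: "real^'n \<Rightarrow> real^'n \<Rightarrow> real^'n^'n" where
  "outer u v = (\<chi> i j. u $ i * v $ j)"

lemma inner_outer: "Y \<bullet> outer u v = u \<bullet> (Y *v v)"
  by (simp add: outer_def inner_vec_def matrix_vector_mult_def sum_distrib_left mult.assoc
      mult.left_commute mult.commute)

lemma outer_mult_vec: "outer u v *v x = (v \<bullet> x) *\<^sub>R u"
  by (simp add: outer_def inner_vec_def matrix_vector_mult_def vec_eq_iff sum_distrib_left mult.assoc
      mult.left_commute mult.commute)

lemma transpose_outer: "transpose (outer u v) = outer v u"
  by (simp add: outer_def transpose_def vec_eq_iff mult.commute)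

lemma subspace_sym_matrices: "subspace (sym_matrices :: (real^'n^'n) set)"
  by (auto simp: subspace_def sym_matrices_def transpose_def vec_eq_iff)

definition ordered_pairs :: "nat set \<Rightarrow> (nat \<times> nat) set" where
  "ordered_pairs I = {(i, j). i \<in> I \<and> j \<in> I \<and> i \<le> j}"

definition sym_unit :: "(nat \<Rightarrow> real^'n) \<Rightarrow> nat \<times> nat \<Rightarrow> real^'n^'n" where
  "sym_unit q = (\<lambda>(i, j). outer (q i) (q j) + outer (q j) (q i))"

lemma finite_ordered_pairs: "finite I \<Longrightarrow> finite (ordered_pairs I)"
  by (rule finite_subset[of _ "I \<times> I"]) (auto simp: ordered_pairs_def)

lemma card_ordered_pairs:
  assumes "finite I"
  shows "2 * card (ordered_pairs I) = card I * (card I + 1)"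
proof -
  let ?R = "(\<lambda>(i, j). (j, i)) ` ordered_pairs I"
  have fin: "finite (ordered_pairs I)" by (rule finite_ordered_pairs[OF assms])
  have un: "ordered_pairs I \<union> ?R = I \<times> I"
    by (auto simp: ordered_pairs_def image_iff)
  have int: "ordered_pairs I \<inter> ?R = (\<lambda>i. (i, i)) ` I"
    by (auto simp: ordered_pairs_def image_iff)
  have "card ?R = card (ordered_pairs I)"
    by (intro card_image) (auto simp: inj_on_def)
  then have "2 * card (ordered_pairs I) = card (I \<times> I) + card ((\<lambda>i. (i, i)) ` I)"
    using card_Un_Int[OF fin, of ?R] fin un int by simp
  also have "card ((\<lambda>i. (i, i)) ` I) = card I" by (intro card_image) (auto simp: inj_on_def)
  finally show ?thesis by (simp add: card_cartesian_product)
qed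

lemma sym_unit_sym: "sym_unit (q :: nat \<Rightarrow> real^'n) t \<in> sym_matrices"
proof -
  have "transpose (A + B) = transpose A + transpose B" for A B :: "real^'n^'n"
    by (simp add: transpose_def vec_eq_iff)
  then show ?thesis
    by (cases t) (simp add: sym_unit_def sym_matrices_def transpose_outer add.commute)
qed

lemma sym_unit_quadratic_form:
  "v \<bullet> (sym_unit q (i, j) *v v) = 2 * ((v \<bullet> q i) * (v \<bullet> q j))"
  by (simp add: sym_unit_def outer_mult_vec matrix_vector_mult_add_rdistrib inner_add_right inner_commute)

lemma sym_unit_inner:
  assumes q: "orthobasis (q :: nat \<Rightarrow> real^'n)"
    and "i \<le> j" "j < CARD('n)" "k \<le> l" "l < CARD('n)"
  shows "sym_unit q (i, j) \<bullet> sym_unit q (k, l) = (if (i, j) = (k, l) then if i = j then 4 else 2 else 0)"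
  using assms orthobasis_inner[OF q]
  by (auto simp: sym_unit_def inner_add_left inner_add_right inner_outer outer_mult_vec
      matrix_vector_mult_add_rdistrib simp del: mult_2 mult_2_right)

lemma dim_sym_units:
  assumes q: "orthobasis (q :: nat \<Rightarrow> real^'n)" and T: "T \<subseteq> ordered_pairs {..<CARD('n)}"
  shows "dim (sym_unit q ` T) = card T"
proof -
  have in_T: "\<exists>i j. t = (i, j) \<and> i \<le> j \<and> j < CARD('n)" if "t \<in> T" for t
    using that T by (auto simp: ordered_pairs_def)
  have self: "sym_unit q t \<bullet> sym_unit q t > 0" if "t \<in> T" for t
  proof -
    obtain i j where "t = (i, j)" "i \<le> j" "j < CARD('n)" using in_T[OF \<open>t \<in> T\<close>] by blast
    then have "sym_unit q t \<bullet> sym_unit q t = (if i = j then 4 else 2)"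
      using sym_unit_inner[OF q, of i j i j] by simp
    then show ?thesis by (simp del: inner_gt_zero_iff)
  qed
  have orth: "sym_unit q t \<bullet> sym_unit q t' = 0" if "t \<in> T" "t' \<in> T" "t \<noteq> t'" for t t'
    using in_T[OF that(1)] in_T[OF that(2)] sym_unit_inner[OF q] that(3)
    by (auto split: if_splits)
  have inj: "inj_on (sym_unit q) T"
    using orth self by (metis inj_onI less_irrefl)
  have "pairwise orthogonal (sym_unit q ` T)"
    unfolding pairwise_def orthogonal_def using orth by blast
  moreover have "0 \<notin> sym_unit q ` T" using self by force
  ultimately have "independent (sym_unit q ` T)" by (rule pairwise_orthogonal_independent)
  then show ?thesis by (simp add: dim_eq_card_independent card_image[OF inj])
qed

text \<open>
  The bound places the perturbation between multiples of the block projection. This is how smallness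
  of a perturbation is measured, because such a matrix cannot affect the eigenvectors outside the
  block.
\<close>

lemma block_form_bound:
  assumes I: "finite I" and D: "D \<in> span (sym_unit q ` ordered_pairs I)"
  obtains K where "K \<ge> 0" "\<And>v. \<bar>v \<bullet> (D *v v)\<bar> \<le> K * (\<Sum>i\<in>I. (v \<bullet> q i)\<^sup>2)"
proof -
  let ?S = "\<lambda>v. \<Sum>i\<in>I. (v \<bullet> q i)\<^sup>2"
  have S: "?S v \<ge> 0" for v by (simp add: sum_nonneg)
  have "\<exists>K\<ge>0. \<forall>v. \<bar>v \<bullet> (D *v v)\<bar> \<le> K * ?S v"
    using D
  proof (induction rule: span_induct_alt)
    case base
    then show ?case by (intro exI[of _ 0]) simp
  next
    case (step c E D)
    then obtain K where K: "K \<ge> 0" "\<And>v. \<bar>v \<bullet> (D *v v)\<bar> \<le> K * ?S v" by blast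
    obtain i j where ij: "i \<in> I" "j \<in> I" "E = sym_unit q (i, j)"
      using step.hyps by (auto simp: ordered_pairs_def)
    have E: "\<bar>v \<bullet> (E *v v)\<bar> \<le> 2 * ?S v" for v
    proof -
      have "(v \<bullet> q i)\<^sup>2 \<le> ?S v" "(v \<bullet> q j)\<^sup>2 \<le> ?S v"
        using member_le_sum[of i I "\<lambda>i. (v \<bullet> q i)\<^sup>2"] member_le_sum[of j I "\<lambda>i. (v \<bullet> q i)\<^sup>2"] ij I
        by auto
      moreover have "\<bar>2 * ((v \<bullet> q i) * (v \<bullet> q j))\<bar> \<le> (v \<bullet> q i)\<^sup>2 + (v \<bullet> q j)\<^sup>2"
        using sum_squares_bound[of "\<bar>v \<bullet> q i\<bar>" "\<bar>v \<bullet> q j\<bar>"] by (simp add: abs_mult)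
      ultimately show ?thesis by (simp add: ij(3) sym_unit_quadratic_form)
    qed
    have "\<bar>v \<bullet> ((c *\<^sub>R E + D) *v v)\<bar> \<le> (2 * \<bar>c\<bar> + K) * ?S v" for v
    proof -
      have "\<bar>v \<bullet> ((c *\<^sub>R E + D) *v v)\<bar> \<le> \<bar>c\<bar> * \<bar>v \<bullet> (E *v v)\<bar> + \<bar>v \<bullet> (D *v v)\<bar>"
        by (simp add: matrix_vector_mult_add_rdistrib inner_add_right scaleR_matrix_vector_assoc[symmetric]
            abs_mult[symmetric] abs_triangle_ineq)
      also have "\<dots> \<le> \<bar>c\<bar> * (2 * ?S v) + K * ?S v"
        using E[of v] K(2)[of v] by (intro add_mono mult_left_mono) auto
      finally show ?thesis by (simp add: algebra_simps)
    qed
    then show ?case using K(1) by (intro exI[of _ "2 * \<bar>c\<bar> + K"]) auto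
  qed
  then show ?thesis using that by blast
qed

text \<open>The projection of \<open>W\<close> to \<open>span S\<close> lowers the dimension, so it has a kernel.\<close>

lemma exists_nonzero_orthogonal:
  fixes W S :: "'a::euclidean_space set"
  assumes W: "subspace W" and less: "dim S < dim W"
  obtains x where "x \<in> W" "x \<noteq> 0" "\<And>a. a \<in> S \<Longrightarrow> a \<bullet> x = 0"
proof -
  obtain B where B: "B \<subseteq> span S" "pairwise orthogonal B" "\<And>x. x \<in> B \<Longrightarrow> norm x = 1"
      "independent B" "card B = dim (span S)" "span B = span S"
    using orthonormal_basis_subspace[OF subspace_span, of S] by metis
  have on: "orthonormal B" using B by (simp add: orthonormal_def)
  have finB: "finite B" by (rule orthonormal_finite[OF on])
  define g where "g = (\<lambda>x. \<Sum>b\<in>B. (x \<bullet> b) *\<^sub>R b)"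
  have g: "linear g"
    by (rule linearI) (simp_all add: g_def inner_add_left scaleR_add_left sum.distrib scaleR_right.sum)
  have "\<not> inj_on g W"
  proof
    assume "inj_on g W"
    then have "dim (g ` W) = dim W"
      using dim_image_eq[OF g] W by (simp add: span_eq_iff[THEN iffD2])
    moreover have "g ` W \<subseteq> span S"
      using B(1) by (auto simp: g_def intro!: span_sum span_scale)
    then have "dim (g ` W) \<le> dim S" using dim_subset[of "g ` W" "span S"] by simp
    ultimately show False using less by simp
  qed
  then obtain x where x: "x \<in> W" "x \<noteq> 0" "g x = 0"
    using linear_injective_on_subspace_0[OF g W] by blast
  have "orthogonal x b" if "b \<in> B" for b
  proof -
    have "g x \<bullet> b = (\<Sum>c\<in>B. if c = b then x \<bullet> c else 0)"
      unfolding g_def inner_sum_left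
      using orthonormal_inner[OF on _ that] by (intro sum.cong) auto
    then have "g x \<bullet> b = x \<bullet> b" using that finB by simp
    then show ?thesis using x(3) by (simp add: orthogonal_def)
  qed
  then have "a \<bullet> x = 0" if "a \<in> S" for a
    using orthogonal_to_span[of a B x] B(6) span_base[OF that]
    by (simp add: orthogonal_def inner_commute)
  then show ?thesis using that x by blast
qed

text \<open>
  Orthogonality to the two block projections expresses tracelessness of the two summands.
\<close>

definition block_projection :: "(nat \<Rightarrow> real^'n) \<Rightarrow> nat set \<Rightarrow> real^'n^'n" where
  "block_projection q I = (\<Sum>i\<in>I. outer (q i) (q i))"

lemma block_form_zero:
  assumes q: "orthobasis (q :: nat \<Rightarrow> real^'n)" and I: "I \<subseteq> {..<CARD('n)}"
    and D: "D \<in> span (sym_unit q ` ordered_pairs I)" and k: "k < CARD('n)" "k \<notin> I"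
  shows "q k \<bullet> (D *v q k) = 0"
proof -
  have finI: "finite I" using I by (rule finite_subset) simp
  obtain K where K: "\<And>v. \<bar>v \<bullet> (D *v v)\<bar> \<le> K * (\<Sum>i\<in>I. (v \<bullet> q i)\<^sup>2)"
    using block_form_bound[OF finI D] by blast
  have "(\<Sum>i\<in>I. (q k \<bullet> q i)\<^sup>2) = 0"
    using orthobasis_inner[OF q k(1)] k I by (intro sum.neutral) auto
  then show ?thesis using K[of "q k"] by simp
qed

text \<open>
  The dimension \<open>d * (d + 1) div 2\<close> of the symmetric matrices on a block of size \<open>d\<close> is lowered by
  one for the trace of each nonempty block, and by \<open>dim S\<close> for the orthogonality constraints.
\<close>

lemma exists_traceless_block_perturbation:
  assumes q: "orthobasis (q :: nat \<Rightarrow> real^'n)"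
    and I: "I \<subseteq> {..<CARD('n)}" and J: "J \<subseteq> {..<CARD('n)}" and disj: "I \<inter> J = {}"
    and count: "2 * (dim S + of_bool (I \<noteq> {}) + of_bool (J \<noteq> {})) <
      card I * (card I + 1) + card J * (card J + 1)"
  obtains D1 D2 where "D1 \<in> span (sym_unit q ` ordered_pairs I)"
    "D2 \<in> span (sym_unit q ` ordered_pairs J)" "D1 + D2 \<noteq> 0"
    "\<And>a. a \<in> S \<Longrightarrow> a \<bullet> (D1 + D2) = 0" "trace D1 = 0" "trace D2 = 0"
proof -
  have fin: "finite I" "finite J" using I J finite_subset by auto
  let ?E = "\<lambda>I. sym_unit q ` ordered_pairs I"
  let ?W = "span (?E I \<union> ?E J)"
  let ?S = "S \<union> ((if I = {} then {} else {block_projection q I}) \<union>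
    (if J = {} then {} else {block_projection q J}))"
  have "ordered_pairs I \<inter> ordered_pairs J = {}" using disj by (auto simp: ordered_pairs_def)
  then have "2 * card (ordered_pairs I \<union> ordered_pairs J) =
      card I * (card I + 1) + card J * (card J + 1)"
    using card_ordered_pairs fin finite_ordered_pairs
    by (simp add: card_Un_disjoint distrib_left del: mult_Suc_right)
  moreover have "dim ?W = card (ordered_pairs I \<union> ordered_pairs J)"
  proof -
    have "ordered_pairs I \<union> ordered_pairs J \<subseteq> ordered_pairs {..<CARD('n)}"
      using I J by (auto simp: ordered_pairs_def)
    from dim_sym_units[OF q this] show ?thesis by (simp add: image_Un)
  qed
  ultimately have W: "card I * (card I + 1) + card J * (card J + 1) = 2 * dim ?W" by simp
  have "dim ?S \<le> dim S + of_bool (I \<noteq> {}) + of_bool (J \<noteq> {})"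
    by (simp add: dim_insert)
  then have "2 * dim ?S \<le> 2 * (dim S + of_bool (I \<noteq> {}) + of_bool (J \<noteq> {}))" by simp
  also note count
  also note W
  finally have "dim ?S < dim ?W" by simp
  then obtain D where D: "D \<in> ?W" "D \<noteq> 0" "\<And>a. a \<in> ?S \<Longrightarrow> a \<bullet> D = 0"
    using exists_nonzero_orthogonal[OF subspace_span, of ?S "?E I \<union> ?E J"] by blast
  obtain D1 D2 where D12: "D1 \<in> span (?E I)" "D2 \<in> span (?E J)" "D = D1 + D2"
    using D(1) by (auto simp: span_Un)
  have tr: "trace D' = 0"
    if "K \<subseteq> {..<CARD('n)}" "D' \<in> span (?E K)" "D'' \<in> span (?E K')" "K' \<subseteq> {..<CARD('n)}"
      "K \<inter> K' = {}" "D = D' + D''" "K \<noteq> {} \<Longrightarrow> block_projection q K \<bullet> D = 0" for K K' D' D''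
  proof -
    have "trace D' = (\<Sum>i\<in>K. q i \<bullet> (D' *v q i))"
      unfolding orthobasis_trace[OF q]
      using block_form_zero[OF q that(1,2)] that(1)
      by (intro sum.mono_neutral_right) auto
    also have "\<dots> = (\<Sum>i\<in>K. q i \<bullet> (D *v q i))"
    proof (rule sum.cong)
      fix i assume "i \<in> K"
      then have "q i \<bullet> (D'' *v q i) = 0"
        using block_form_zero[OF q that(4,3), of i] that(1,5) by auto
      then show "q i \<bullet> (D' *v q i) = q i \<bullet> (D *v q i)"
        by (simp add: that(6) matrix_vector_mult_add_rdistrib inner_add_right)
    qed simp
    also have "\<dots> = block_projection q K \<bullet> D"
      by (simp add: block_projection_def inner_sum_left inner_commute[of "outer _ _"] inner_outer)
    also have "\<dots> = 0"
      using that(7) by (cases "K = {}") (auto simp: block_projection_def)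
    finally show ?thesis .
  qed
  show ?thesis
  proof (rule that[OF D12(1,2)])
    show "trace D1 = 0" by (rule tr[OF I D12(1,2) J disj D12(3)]) (use D(3) in simp)
    show "trace D2 = 0"
      by (rule tr[OF J D12(2,1) I]) (use D(3) D12(3) disj in \<open>auto simp: add.commute\<close>)
  qed (use D D12(3) in auto)
qed

section \<open>Low rank or perturbable\<close>

lemma rank_le_nonzero_eigenvalues:
  fixes X :: "real^'n^'n"
  assumes q: "orthobasis q" and eig: "\<And>i. i < CARD('n) \<Longrightarrow> X *v q i = L i *\<^sub>R q i"
  shows "rank X \<le> card {i. i < CARD('n) \<and> L i \<noteq> 0}"
proof -
  let ?Z = "{i. i < CARD('n) \<and> L i \<noteq> 0}"
  have "range ((*v) X) \<subseteq> span (q ` ?Z)"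
  proof
    fix y assume "y \<in> range ((*v) X)"
    then obtain x where y: "y = X *v x" by blast
    have "x = (\<Sum>i<CARD('n). (x \<bullet> q i) *\<^sub>R q i)"
      using orthonormal_expand[OF orthobasis_orthonormal[OF q order_refl] orthobasis_span[OF q], of x]
      by (simp add: sum.reindex[OF orthobasis_inj[OF q]])
    then have "y = X *v (\<Sum>i<CARD('n). (x \<bullet> q i) *\<^sub>R q i)" using y by simp
    also have "\<dots> = (\<Sum>i<CARD('n). (x \<bullet> q i) *\<^sub>R (L i *\<^sub>R q i))"
      using eig by (simp add: linear_sum[OF matrix_vector_mul_linear] matrix_vector_mult_scaleR)
    also have "\<dots> \<in> span (q ` ?Z)"
    proof (rule span_sum)
      fix i assume i: "i \<in> {..<CARD('n)}"
      show "(x \<bullet> q i) *\<^sub>R (L i *\<^sub>R q i) \<in> span (q ` ?Z)"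
      proof (cases "L i = 0")
        case False
        then show ?thesis using i by (intro span_scale span_base) auto
      qed (simp add: span_zero)
    qed
    finally show "y \<in> span (q ` ?Z)" .
  qed
  then have "rank X \<le> dim (span (q ` ?Z))"
    unfolding rank_dim_range by (rule dim_subset)
  also have "\<dots> \<le> card (q ` ?Z)" by (simp add: dim_le_card')
  also have "\<dots> \<le> card ?Z" by (intro card_image_le) simp
  finally show ?thesis .
qed

lemma card_excess_block:
  assumes "u < p \<Longrightarrow> u \<ge> 1"
  shows "card (excess_block u p) = (if p - u = 0 then 0 else p - u + 1)"
  using assms by (auto simp: excess_block_def)

lemma excess_block_empty_iff: "excess_block u p = {} \<longleftrightarrow> p - u = 0"
  by (auto simp: excess_block_def)

text \<open>A nonincreasing vector is constant between two positions at which it has the same value.\<close>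

lemma vanishing_block:
  fixes x :: "real^'n::{finite,linorder}"
  assumes x: "nonincreasing x" and r: "r < CARD('n)" and s: "s \<in> {1..r + 1}"
    and z: "vec_comp x s = 0" "vec_comp x (s + CARD('n) - r - 1) = 0"
    and i: "s - 1 \<le> i" "i < CARD('n) - (r + 1 - s)"
  shows "x $ idx i = 0"
proof -
  let ?t = "s + CARD('n) - r - 1 - 1"
  have "x $ idx (s - 1) = 0" using z(1) s r by (subst (asm) vec_comp_eq) auto
  moreover have "x $ idx ?t = 0" using z(2) s r by (subst (asm) vec_comp_eq) auto
  moreover have "x $ idx i \<le> x $ idx (s - 1)" using i by (intro nonincreasing_idx[OF x]) auto
  moreover have "x $ idx ?t \<le> x $ idx i" using i s r by (intro nonincreasing_idx[OF x]) auto
  ultimately show ?thesis by simp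
qed

text \<open>
  The summands of a traceless block perturbation perturb the positive and the negative part of \<open>X\<close>,
  each of which tolerates it if it is small. Both signs of the perturbation are admissible because
  the smallness conditions are symmetric. If no nonzero block perturbation is orthogonal to \<open>S\<close>,
  counting dimensions bounds the excesses.

  The numbers \<open>e1\<close> and \<open>e2\<close> are the excesses of the numbers of positive and of negative
  eigenvalues over the numbers of entries of \<open>x\<close> before and after its zero block.
\<close>

proposition perturbable_or_low_rank:
  fixes X :: "'n::{finite,linorder} sqmat" and S :: "'n::{finite,linorder} sqmat set"
  assumes X: "X \<in> sym_matrices" and x: "nonincreasing x"
    and r: "r < CARD('n)" and s: "s \<in> {1..r + 1}"
    and z: "vec_comp x s = 0" "vec_comp x (s + CARD('n) - r - 1) = 0"
    and maj: "x \<succeq> eigvals X"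
  shows "(\<exists>D. D \<noteq> 0 \<and> X + D \<in> sym_matrices \<and> X - D \<in> sym_matrices \<and> (\<forall>a\<in>S. a \<bullet> D = 0) \<and>
            x \<succeq> eigvals (X + D) \<and> x \<succeq> eigvals (X - D)) \<or>
         (\<exists>e1 e2. rank X \<le> r + e1 + e2 \<and> e1 * e1 + 3 * e1 + (e2 * e2 + 3 * e2) \<le> 2 * dim S \<and>
            (s = 1 \<longrightarrow> e1 = 0) \<and> (s = r + 1 \<longrightarrow> e2 = 0))"
proof -
  define n where "n = CARD('n)"
  define u w where "u = s - 1" and "w = r + 1 - s"
  have uw: "u + w = r" "u \<le> n - w" "n - w \<le> n" "r < n" using s r by (auto simp: u_def w_def n_def)
  obtain q :: "nat \<Rightarrow> real^'n::{finite,linorder}" where e: "nonincreasing (eigvals X)" and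
    qo: "\<And>i j. i < CARD('n) \<Longrightarrow> j < CARD('n) \<Longrightarrow> q i \<bullet> q j = (if i = j then 1 else 0)"
    and eig: "\<And>i. i < CARD('n) \<Longrightarrow> X *v q i = eigvals X $ idx i *\<^sub>R q i"
    using eigvals_eigenbasis[OF X] by blast
  have q: "orthobasis q" using qo by (simp add: orthobasis_def)
  define L a where "L = (\<lambda>i. eigvals X $ idx i)" and "a = (\<lambda>i. x $ idx i)"
  have L: "L j \<le> L i" if "i \<le> j" "j < CARD('n)" for i j
    using nonincreasing_idx[OF e that] by (simp add: L_def)
  have a: "a j \<le> a i" if "i \<le> j" "j < CARD('n)" for i j
    using nonincreasing_idx[OF x that] by (simp add: a_def)
  have a_zero: "a i = 0" if "u \<le> i" "i < n - w" for i
    using vanishing_block[OF x r s z] that by (simp add: a_def u_def w_def n_def)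
  have a_nonpos: "a i \<le> 0" if "u \<le> i" "i < CARD('n)" for i
    using a[OF that] a_zero[of u] uw by simp
  have a_nonneg: "a i \<ge> 0" if "i < n - w" for i
    using a[of i "n - w - 1"] a_zero[of "n - w - 1"] that uw by (simp add: n_def)
  have dom: "(\<Sum>i<l. L i) \<le> (\<Sum>i<l. a i)" if "l \<le> CARD('n)" for l
  proof (cases "l = 0")
    case False
    then have "sum_largest l (eigvals X) \<le> sum_largest l x"
      using maj that by (simp add: majorizes_def)
    then show ?thesis
      by (simp add: sum_largest_nonincreasing[OF e that] sum_largest_nonincreasing[OF x that] L_def a_def)
  qed simp
  have tot: "(\<Sum>i<n. L i) = (\<Sum>i<n. a i)"
    using maj unfolding majorizes_def by (simp add: sum_idx L_def a_def n_def)
  have trX: "trace X = (\<Sum>i<n. a i)"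
    using orthobasis_trace[OF q, of X] eig qo by (simp add: n_def L_def tot[symmetric, unfolded n_def])

  define p where "p = card {i. i < CARD('n) \<and> L i > 0}"
  define p' where "p' = card {i. i < CARD('n) \<and> - L (CARD('n) - 1 - i) > 0}"
  interpret pos: dominated_spectrum q "\<lambda>i. max 0 (L i)" "\<lambda>i. max 0 (a i)" u p
    unfolding p_def by (rule dominated_spectrum_positive_part[OF q L a a_nonpos dom])
  interpret neg: dominated_spectrum "\<lambda>i. q (CARD('n) - 1 - i)" "\<lambda>i. max 0 (- L (CARD('n) - 1 - i))"
      "\<lambda>i. max 0 (- a (CARD('n) - 1 - i))" w p'
    unfolding p'_def
  proof (rule dominated_spectrum_positive_part[OF orthobasis_reverse[OF q]])
    fix l assume l: "l \<le> CARD('n)"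
    show "(\<Sum>i<l. - L (CARD('n) - 1 - i)) \<le> (\<Sum>i<l. - a (CARD('n) - 1 - i))"
      using dom[of "CARD('n) - l"] tot sum_reversed_prefix[OF l, of L] sum_reversed_prefix[OF l, of a]
      by (simp add: sum_negf n_def)
  next
    fix i assume "w \<le> i" "i < CARD('n)"
    then show "- a (CARD('n) - 1 - i) \<le> 0"
      using a_nonneg[of "n - 1 - i"] uw by (simp add: n_def)
  qed (use L a in auto)

  \<comment> \<open>the negative part was enumerated backwards; \<open>J\<close> is its block in the indices of \<open>q\<close>\<close>
  let ?rev = "\<lambda>i. CARD('n) - 1 - i"
  define I J where "I = excess_block u p" and "J = ?rev ` excess_block w p'"
  have inj: "inj_on ?rev {..<CARD('n)}" by (auto simp: inj_on_def)
  have I: "I \<subseteq> {..<CARD('n)}" using pos.excess_block_subset by (simp add: I_def)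
  have J: "J \<subseteq> {..<CARD('n)}" using neg.excess_block_subset by (auto simp: J_def)
  have fin: "finite I" "finite J" using I J finite_subset by auto
  have sumJ: "(\<Sum>i\<in>excess_block w p'. g (?rev i)) = (\<Sum>j\<in>J. g j)" for g :: "nat \<Rightarrow> real"
    unfolding J_def using inj_on_subset[OF inj neg.excess_block_subset] by (simp add: sum.reindex)
  have cardJ: "card J = card (excess_block w p')"
    unfolding J_def using inj_on_subset[OF inj neg.excess_block_subset] by (rule card_image)
  have disj: "I \<inter> J = {}"
  proof (rule ccontr)
    assume "I \<inter> J \<noteq> {}"
    then obtain i where i: "i \<in> excess_block u p" "?rev i \<in> excess_block w p'" "i < CARD('n)"
      using I neg.excess_block_subset by (fastforce simp: I_def J_def)
    then have "i < p" "?rev i < p'" by (auto simp: excess_block_def split: if_splits)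
    then have "L i > 0" "- L (?rev (?rev i)) > 0"
      using pos.L_pos_iff[OF i(3)] neg.L_pos_iff[of "?rev i"] by (auto simp: less_max_iff_disj)
    then show False using i(3) by simp
  qed
  define e1 e2 where "e1 = p - u" and "e2 = p' - w"
  have cards: "card I = (if e1 = 0 then 0 else e1 + 1)" "card J = (if e2 = 0 then 0 else e2 + 1)"
    unfolding cardJ unfolding I_def e1_def e2_def
    by (rule card_excess_block, erule pos.excess_imp_support_nonempty)
       (rule card_excess_block, erule neg.excess_imp_support_nonempty)
  have empty: "I \<noteq> {} \<longleftrightarrow> e1 \<noteq> 0" "J \<noteq> {} \<longleftrightarrow> e2 \<noteq> 0"
    by (simp_all add: I_def J_def e1_def e2_def excess_block_empty_iff)

  show ?thesis
  proof (cases "2 * (dim S + of_bool (I \<noteq> {}) + of_bool (J \<noteq> {})) <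
      card I * (card I + 1) + card J * (card J + 1)")
    case False
    then have "e1 * e1 + 3 * e1 + (e2 * e2 + 3 * e2) \<le> 2 * dim S"
      unfolding cards empty by (auto simp: algebra_simps split: if_splits)
    moreover have "rank X \<le> r + e1 + e2"
    proof -
      have "{i. i < CARD('n) \<and> L i \<noteq> 0} =
          {i. i < CARD('n) \<and> L i > 0} \<union> ?rev ` {i. i < CARD('n) \<and> - L (?rev i) > 0}"
      proof (intro equalityI subsetI)
        fix i assume i: "i \<in> {i. i < CARD('n) \<and> L i \<noteq> 0}"
        then have "i = ?rev (?rev i)" "?rev i < CARD('n)" by auto
        then show "i \<in> {i. i < CARD('n) \<and> L i > 0} \<union> ?rev ` {i. i < CARD('n) \<and> - L (?rev i) > 0}"
          using i by (cases "L i > 0") (auto intro!: image_eqI[of _ _ "?rev i"])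
      qed auto
      then have "card {i. i < CARD('n) \<and> L i \<noteq> 0} \<le> p + p'"
        unfolding p_def p'_def
        by (simp only:) (rule order_trans[OF card_Un_le add_left_mono[OF card_image_le]], simp)
      moreover have "rank X \<le> card {i. i < CARD('n) \<and> L i \<noteq> 0}"
        using eig by (intro rank_le_nonzero_eigenvalues[OF q]) (simp add: L_def)
      moreover have "p \<le> u + e1" "p' \<le> w + e2" by (simp_all add: e1_def e2_def)
      ultimately show ?thesis using uw(1) by linarith
    qed
    moreover have "e1 = 0" if "s = 1"
      using pos.excess_imp_support_nonempty that by (fastforce simp: e1_def u_def)
    moreover have "e2 = 0" if "s = r + 1"
      using neg.excess_imp_support_nonempty that by (fastforce simp: e2_def w_def)
    ultimately show ?thesis by blast
  next
    case True
    obtain D1 D2 where D: "D1 \<in> span (sym_unit q ` ordered_pairs I)"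
      "D2 \<in> span (sym_unit q ` ordered_pairs J)" "D1 + D2 \<noteq> 0"
      "\<And>a. a \<in> S \<Longrightarrow> a \<bullet> (D1 + D2) = 0" "trace D1 = 0" "trace D2 = 0"
      using exists_traceless_block_perturbation[OF q I J disj True] by blast
    obtain K1 where K1: "K1 \<ge> 0" "\<And>v. \<bar>v \<bullet> (D1 *v v)\<bar> \<le> K1 * (\<Sum>i\<in>I. (v \<bullet> q i)\<^sup>2)"
      using block_form_bound[OF fin(1) D(1)] by blast
    obtain K2 where K2: "K2 \<ge> 0" "\<And>v. \<bar>v \<bullet> (D2 *v v)\<bar> \<le> K2 * (\<Sum>i\<in>J. (v \<bullet> q i)\<^sup>2)"
      using block_form_bound[OF fin(2) D(2)] by blast
    obtain \<epsilon>1 where \<epsilon>1: "\<epsilon>1 > 0"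
      "\<And>D v. \<bar>v \<bullet> (D *v v)\<bar> \<le> \<epsilon>1 * (\<Sum>i\<in>I. (v \<bullet> q i)\<^sup>2) \<Longrightarrow>
        (\<Sum>i<CARD('n). max 0 (L i) * (v \<bullet> q i)\<^sup>2) + v \<bullet> (D *v v) \<ge> 0"
      "\<And>D B. \<lbrakk>\<And>v. \<bar>v \<bullet> (D *v v)\<bar> \<le> \<epsilon>1 * (\<Sum>i\<in>I. (v \<bullet> q i)\<^sup>2); trace D = 0; orthonormal B\<rbrakk> \<Longrightarrow>
        (\<Sum>v\<in>B. (\<Sum>i<CARD('n). max 0 (L i) * (v \<bullet> q i)\<^sup>2) + v \<bullet> (D *v v)) \<le> (\<Sum>i<card B. max 0 (a i))"
      unfolding I_def using pos.perturbation_dominated by blast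
    obtain \<epsilon>2 where \<epsilon>2: "\<epsilon>2 > 0"
      "\<And>D v. \<bar>v \<bullet> (D *v v)\<bar> \<le> \<epsilon>2 * (\<Sum>i\<in>J. (v \<bullet> q i)\<^sup>2) \<Longrightarrow>
        (\<Sum>i<CARD('n). max 0 (- L (?rev i)) * (v \<bullet> q (?rev i))\<^sup>2) + v \<bullet> (D *v v) \<ge> 0"
      "\<And>D B. \<lbrakk>\<And>v. \<bar>v \<bullet> (D *v v)\<bar> \<le> \<epsilon>2 * (\<Sum>i\<in>J. (v \<bullet> q i)\<^sup>2); trace D = 0; orthonormal B\<rbrakk> \<Longrightarrow>
        (\<Sum>v\<in>B. (\<Sum>i<CARD('n). max 0 (- L (?rev i)) * (v \<bullet> q (?rev i))\<^sup>2) + v \<bullet> (D *v v)) \<le>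
        (\<Sum>i<card B. max 0 (- a (?rev i)))"
      unfolding sumJ[symmetric] using neg.perturbation_dominated by blast
    \<comment> \<open>the added 1 avoids division by zero for a summand that vanishes\<close>
    define \<tau> where "\<tau> = min (\<epsilon>1 / (K1 + 1)) (\<epsilon>2 / (K2 + 1))"
    have \<tau>: "\<tau> > 0" "\<tau> * K1 \<le> \<epsilon>1" "\<tau> * K2 \<le> \<epsilon>2"
    proof -
      show "\<tau> > 0" using \<epsilon>1(1) \<epsilon>2(1) K1(1) K2(1) by (simp add: \<tau>_def)
      then have "\<tau> * K1 \<le> \<tau> * (K1 + 1)" "\<tau> * K2 \<le> \<tau> * (K2 + 1)" by simp_all
      moreover have "\<tau> \<le> \<epsilon>1 / (K1 + 1)" "\<tau> \<le> \<epsilon>2 / (K2 + 1)" by (simp_all add: \<tau>_def)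
      then have "\<tau> * (K1 + 1) \<le> \<epsilon>1" "\<tau> * (K2 + 1) \<le> \<epsilon>2"
        using K1(1) K2(1) by (simp_all add: pos_le_divide_eq)
      ultimately show "\<tau> * K1 \<le> \<epsilon>1" "\<tau> * K2 \<le> \<epsilon>2" by simp_all
    qed
    have sym: "D1 + D2 \<in> sym_matrices"
    proof -
      have "span (sym_unit q ` T) \<subseteq> sym_matrices" for T
        by (intro span_minimal subspace_sym_matrices) (auto simp: sym_unit_sym)
      then show ?thesis using D(1,2) subspace_add[OF subspace_sym_matrices] by blast
    qed
    have main: "X + \<sigma> *\<^sub>R (D1 + D2) \<in> sym_matrices \<and> x \<succeq> eigvals (X + \<sigma> *\<^sub>R (D1 + D2))"
      if \<sigma>: "\<bar>\<sigma>\<bar> = \<tau>" for \<sigma>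
    proof -
      have sY: "X + \<sigma> *\<^sub>R (D1 + D2) \<in> sym_matrices"
        by (intro subspace_add subspace_scale subspace_sym_matrices X sym)
      have trs: "trace (c *\<^sub>R M) = c * trace M" for c and M :: "'n sqmat"
        by (simp add: trace_def sum_distrib_left)
      have form: "v \<bullet> ((c *\<^sub>R M) *v v) = c * (v \<bullet> (M *v v))" for c v and M :: "'n sqmat"
        by (simp add: scaleR_matrix_vector_assoc[symmetric])
      have b1: "\<bar>v \<bullet> ((\<sigma> *\<^sub>R D1) *v v)\<bar> \<le> \<epsilon>1 * (\<Sum>i\<in>I. (v \<bullet> q i)\<^sup>2)" for v
      proof -
        have "\<bar>v \<bullet> ((\<sigma> *\<^sub>R D1) *v v)\<bar> \<le> \<tau> * (K1 * (\<Sum>i\<in>I. (v \<bullet> q i)\<^sup>2))"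
          unfolding form abs_mult \<sigma> using \<tau>(1) K1(2) by (intro mult_left_mono) auto
        also have "\<dots> \<le> \<epsilon>1 * (\<Sum>i\<in>I. (v \<bullet> q i)\<^sup>2)"
          unfolding mult.assoc[symmetric] by (intro mult_right_mono \<tau>(2) sum_nonneg) simp
        finally show ?thesis .
      qed
      have b2: "\<bar>v \<bullet> (((- \<sigma>) *\<^sub>R D2) *v v)\<bar> \<le> \<epsilon>2 * (\<Sum>i\<in>J. (v \<bullet> q i)\<^sup>2)" for v
      proof -
        have "\<bar>v \<bullet> (((- \<sigma>) *\<^sub>R D2) *v v)\<bar> \<le> \<tau> * (K2 * (\<Sum>i\<in>J. (v \<bullet> q i)\<^sup>2))"
          unfolding form abs_mult abs_minus_cancel \<sigma> using \<tau>(1) K2(2) by (intro mult_left_mono) auto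
        also have "\<dots> \<le> \<epsilon>2 * (\<Sum>i\<in>J. (v \<bullet> q i)\<^sup>2)"
          unfolding mult.assoc[symmetric] by (intro mult_right_mono \<tau>(3) sum_nonneg) simp
        finally show ?thesis .
      qed
      have neg_form: "f - v \<bullet> ((\<sigma> *\<^sub>R D2) *v v) = f + v \<bullet> (((- \<sigma>) *\<^sub>R D2) *v v)" for f v
        unfolding form by simp
      have "ky_fan_dominated (X + (\<sigma> *\<^sub>R D1 + \<sigma> *\<^sub>R D2)) a"
      proof (rule dominated_of_parts[where q = q and L = L and u = u and h = "n - w"], unfold neg_form)
        show "v \<bullet> (X *v v) = (\<Sum>i<CARD('n). L i * (v \<bullet> q i)\<^sup>2)" for v
          using eig by (intro spectral_quadratic_form[OF X q]) (simp add: L_def)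
        show "0 \<le> (\<Sum>i<CARD('n). max 0 (L i) * (v \<bullet> q i)\<^sup>2) + v \<bullet> ((\<sigma> *\<^sub>R D1) *v v)" for v
          by (rule \<epsilon>1(2)[OF b1])
        show "0 \<le> (\<Sum>i<CARD('n). max 0 (- L (?rev i)) * (v \<bullet> q (?rev i))\<^sup>2) +
            v \<bullet> (((- \<sigma>) *\<^sub>R D2) *v v)" for v
          by (rule \<epsilon>2(2)[OF b2])
        show "(\<Sum>v\<in>B. (\<Sum>i<CARD('n). max 0 (L i) * (v \<bullet> q i)\<^sup>2) + v \<bullet> ((\<sigma> *\<^sub>R D1) *v v)) \<le>
            (\<Sum>i<card B. max 0 (a i))" if "orthonormal B" for B
          by (rule \<epsilon>1(3)[OF b1 _ that]) (simp add: trs D(5))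
        show "(\<Sum>v\<in>B. (\<Sum>i<CARD('n). max 0 (- L (?rev i)) * (v \<bullet> q (?rev i))\<^sup>2) +
            v \<bullet> (((- \<sigma>) *\<^sub>R D2) *v v)) \<le> (\<Sum>i<card B. max 0 (- a (?rev i)))" if "orthonormal B" for B
          by (rule \<epsilon>2(3)[OF b2 _ that]) (simp only: trs D(6) mult_zero_right)
      qed (use trX uw a_nonneg a_nonpos D(5,6) in \<open>auto simp: trs n_def\<close>)
      then have "ky_fan_dominated (X + \<sigma> *\<^sub>R (D1 + D2)) (\<lambda>i. x $ idx i)"
        by (simp add: scaleR_add_right a_def)
      moreover have "(\<Sum>i\<in>UNIV. x $ i) = trace (X + \<sigma> *\<^sub>R (D1 + D2))"
        using trX D(5,6) by (simp add: trace_add trs sum_idx a_def n_def)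
      ultimately show ?thesis using majorizes_eigvals_iff[OF sY x] sY by blast
    qed
    have "\<tau> *\<^sub>R (D1 + D2) \<noteq> 0" using \<tau>(1) D(3) by simp
    moreover have "a \<bullet> (\<tau> *\<^sub>R (D1 + D2)) = 0" if "a \<in> S" for a
      using D(4)[OF that] by simp
    ultimately show ?thesis
      using main[of \<tau>] main[of "- \<tau>"] \<tau>(1)
      by (intro disjI1 exI[of _ "\<tau> *\<^sub>R (D1 + D2)"]) auto
  qed
qed

section \<open>Extreme points and optimal solutions\<close>

lemma affine_contains_line:
  assumes "affine S" "x \<in> S" "y \<in> S" "x \<noteq> y"
  shows "contains_line S"
  unfolding contains_line_def
proof (intro exI conjI allI)
  show "y - x \<noteq> 0" using assms(4) by simp
  fix t :: real
  have "(1 - t) *\<^sub>R x + t *\<^sub>R y \<in> S" using assms by (intro mem_affine) auto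
  then show "x + t *\<^sub>R (y - x) \<in> S" by (simp add: algebra_simps)
qed

text \<open>
  Induction on the dimension: a line-free set with more than one point is not affine, hence has a
  relative boundary point, and the face cut out there by a supporting hyperplane is smaller.
\<close>

lemma closed_convex_line_free_has_extreme_point:
  fixes S :: "'a::euclidean_space set"
  assumes "closed S" "convex S" "S \<noteq> {}" "\<not> contains_line S"
  shows "\<exists>x. x extreme_point_of S"
  using assms
proof (induction "nat (aff_dim S + 1)" arbitrary: S rule: less_induct)
  case less
  show ?case
  proof (cases "affine S")
    case True
    obtain x where "x \<in> S" using less.prems(3) by blast
    then have "S = {x}" using affine_contains_line[OF True] less.prems(4) by blast
    then show ?thesis by auto
  next
    case False
    then obtain x where "x \<in> rel_frontier S" using rel_frontier_eq_empty by blast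
    then have x: "x \<in> S" "x \<notin> rel_interior S"
      using less.prems(1) by (auto simp: rel_frontier_def)
    obtain a where a: "a \<noteq> 0" "\<And>y. y \<in> S \<Longrightarrow> a \<bullet> x \<le> a \<bullet> y"
        "\<And>y. y \<in> rel_interior S \<Longrightarrow> a \<bullet> x < a \<bullet> y"
      using supporting_hyperplane_rel_boundary[OF less.prems(2) x] by blast
    define F where "F = S \<inter> {y. a \<bullet> y = a \<bullet> x}"
    have face: "F face_of S"
      unfolding F_def using a(2) by (intro face_of_Int_supporting_hyperplane_ge less.prems(2))
    obtain y where "y \<in> rel_interior S"
      using less.prems(2,3) rel_interior_eq_empty by blast
    then have "y \<in> S" "y \<notin> F" using a(3)[of y] rel_interior_subset by (auto simp: F_def)
    then have "F \<noteq> S" by blast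
    then have "aff_dim F < aff_dim S"
      using face_of_aff_dim_lt[OF less.prems(2) face] by simp
    moreover have "aff_dim F \<ge> -1" by (rule aff_dim_geq)
    ultimately have "nat (aff_dim F + 1) < nat (aff_dim S + 1)" by simp
    moreover have "closed F" unfolding F_def by (intro closed_Int less.prems(1) closed_hyperplane)
    moreover have "convex F" unfolding F_def by (intro convex_Int less.prems(2) convex_hyperplane)
    moreover have "F \<noteq> {}" using x(1) by (auto simp: F_def)
    moreover have "\<not> contains_line F"
      using less.prems(4) unfolding contains_line_def F_def by blast
    ultimately obtain z where "z extreme_point_of F" using less.hyps by blast
    then show ?thesis using extreme_point_of_face[OF face] by blast
  qed
qed

lemma extreme_point_perturbation:
  fixes X :: "'a::euclidean_space"
  assumes "X extreme_point_of S" "X + D \<in> S" "X - D \<in> S"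
  shows "D = 0"
proof (rule ccontr)
  assume "D \<noteq> 0"
  then have "2 *\<^sub>R D \<noteq> 0" by simp
  moreover have "(X + D) - (X - D) = 2 *\<^sub>R D" by (simp add: scaleR_2)
  ultimately have "X + D \<noteq> X - D" by (metis diff_self)
  then have "midpoint (X + D) (X - D) \<in> open_segment (X + D) (X - D)" by simp
  moreover have "midpoint (X + D) (X - D) = X" by (simp add: midpoint_def scaleR_2[symmetric])
  ultimately show False using assms unfolding extreme_point_of_def by metis
qed

text \<open>
  The inequality is twice the dimension count: a block of size \<open>e + 1\<close> carries a space of traceless
  symmetric matrices of dimension \<open>(e + 1) * (e + 2) / 2 - 1\<close>.
\<close>

definition excess_bound :: "nat \<Rightarrow> nat \<Rightarrow> nat \<Rightarrow> nat \<Rightarrow> bool" where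
  "excess_bound r s d N \<longleftrightarrow> (\<exists>e1 e2. N \<le> r + e1 + e2 \<and>
     e1 * e1 + 3 * e1 + (e2 * e2 + 3 * e2) \<le> 2 * d \<and> (s = 1 \<longrightarrow> e1 = 0) \<and> (s = r + 1 \<longrightarrow> e2 = 0))"

text \<open>The worst case is an excess split evenly between the two signs.\<close>

lemma excess_bound_two_sided:
  assumes "excess_bound r s d N"
  shows "int N \<le> int r + \<lfloor>sqrt (4 * real d + 9) - 3\<rfloor>"
proof -
  obtain e1 e2 where e: "N \<le> r + e1 + e2" "e1 * e1 + 3 * e1 + (e2 * e2 + 3 * e2) \<le> 2 * d"
    using assms by (auto simp: excess_bound_def)
  have "real (e1 * e1 + 3 * e1 + (e2 * e2 + 3 * e2)) \<le> real (2 * d)"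
    using e(2) of_nat_le_iff by blast
  then have "real e1 * real e1 + 3 * real e1 + (real e2 * real e2 + 3 * real e2) \<le> 2 * real d"
    by simp
  moreover have "0 \<le> (real e1 - real e2)\<^sup>2" by simp
  ultimately have "(real (e1 + e2) + 3)\<^sup>2 \<le> 4 * real d + 9"
    by (simp add: power2_eq_square algebra_simps)
  then have "real (e1 + e2) + 3 \<le> sqrt (4 * real d + 9)" by (rule real_le_rsqrt)
  then have "int (e1 + e2) \<le> \<lfloor>sqrt (4 * real d + 9) - 3\<rfloor>" by (subst le_floor_iff) simp
  then show ?thesis using e(1) by linarith
qed

lemma excess_bound_one_sided:
  assumes "excess_bound r s d N" "s = 1 \<or> s = r + 1"
  shows "int N \<le> int r + \<lfloor>sqrt (2 * real d + 9 / 4) - 3 / 2\<rfloor>"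
proof -
  obtain e1 e2 where "N \<le> r + e1 + e2" "e1 * e1 + 3 * e1 + (e2 * e2 + 3 * e2) \<le> 2 * d"
      "e1 = 0 \<or> e2 = 0"
    using assms unfolding excess_bound_def by blast
  then have "N \<le> r + (e1 + e2)" "(e1 + e2) * (e1 + e2) + 3 * (e1 + e2) \<le> 2 * d" by auto
  then obtain e where e: "N \<le> r + e" "e * e + 3 * e \<le> 2 * d" by blast
  have "real (e * e + 3 * e) \<le> real (2 * d)"
    using e(2) of_nat_le_iff by blast
  then have "(real e + 3 / 2)\<^sup>2 \<le> 2 * real d + 9 / 4"
    by (simp add: power2_eq_square algebra_simps)
  then have "real e + 3 / 2 \<le> sqrt (2 * real d + 9 / 4)" by (rule real_le_rsqrt)
  then have "int e \<le> \<lfloor>sqrt (2 * real d + 9 / 4) - 3 / 2\<rfloor>" by (subst le_floor_iff) simp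
  then show ?thesis using e(1) by linarith
qed

lemma excess_bound_full_rank:
  assumes "CARD('n) \<le> r"
  shows "excess_bound r s d (rank (X :: real^'n^'n))"
  using rank_bound[of X] assms by (auto simp: excess_bound_def intro!: exI[of _ 0])

text \<open>
  The pairs of a feasible matrix of objective value \<open>v\<close> and a witness vector. Unlike its projection
  to the matrices, this set is visibly closed. It is used only for \<open>r < n\<close>, where the zero block is
  nonempty.
\<close>

definition lifted_level_set ::
    "(real^'n::{finite,linorder} \<Rightarrow> real) \<Rightarrow> nat \<Rightarrow> (nat \<Rightarrow> 'n::{finite,linorder} sqmat) \<Rightarrow>
     (nat \<Rightarrow> ereal) \<Rightarrow> (nat \<Rightarrow> ereal) \<Rightarrow> nat \<Rightarrow> nat \<Rightarrow> real \<Rightarrow>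
     ('n::{finite,linorder} sqmat \<times> (real^'n::{finite,linorder})) set" where
  "lifted_level_set f r A bl bu m s v =
     {(X, x). X \<in> sym_matrices \<and> f x \<le> 0 \<and> nonincreasing x \<and>
        vec_comp x s = 0 \<and> vec_comp x (s + CARD('n) - r - 1) = 0 \<and> x \<succeq> eigvals X \<and>
        (\<forall>i\<in>{1..m}. bl i \<le> ereal (A i \<bullet> X) \<and> ereal (A i \<bullet> X) \<le> bu i) \<and> A 0 \<bullet> X = v}"

text \<open>
  All conditions become constraints by continuous convex functions of the pair: the matrix enters
  through the linear functionals \<open>X \<bullet> outer v v = v \<bullet> (X *v v)\<close>.
\<close>

lemma lifted_level_set_ky_fan:
  fixes f :: "real^'n::{finite,linorder} \<Rightarrow> real"
  assumes r: "r < CARD('n)" and s: "s \<in> {1..r + 1}"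
  shows "(X, x) \<in> lifted_level_set f r A bl bu m s v \<longleftrightarrow>
     X \<in> sym_matrices \<and> f x \<le> 0 \<and> (\<forall>i j. i \<le> j \<longrightarrow> x $ j \<le> x $ i) \<and>
     x $ idx (s - 1) = 0 \<and> x $ idx (s + CARD('n) - r - 1 - 1) = 0 \<and>
     (\<forall>B. orthonormal B \<longrightarrow> (\<Sum>v\<in>B. X \<bullet> outer v v) \<le> (\<Sum>i<card B. x $ idx i)) \<and>
     (\<Sum>i\<in>UNIV. x $ i) = (\<Sum>i\<in>UNIV. X $ i $ i) \<and>
     (\<forall>i\<in>{1..m}. bl i \<le> ereal (A i \<bullet> X) \<and> ereal (A i \<bullet> X) \<le> bu i) \<and> A 0 \<bullet> X = v"
proof -
  have "s - 1 < CARD('n)" "s + CARD('n) - r - 1 - 1 < CARD('n)" using r s by auto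
  then show ?thesis
    unfolding lifted_level_set_def
    using majorizes_eigvals_iff[of X x]
    by (auto simp: vec_comp_eq nonincreasing_def ky_fan_dominated_def inner_outer trace_def)
qed

lemma closed_lifted_level_set:
  fixes f :: "real^'n::{finite,linorder} \<Rightarrow> real"
  assumes r: "r < CARD('n)" and s: "s \<in> {1..r + 1}" and f: "continuous_on UNIV f"
  shows "closed (lifted_level_set f r A bl bu m s v)"
proof -
  have fsnd: "continuous_on UNIV (\<lambda>p :: 'n sqmat \<times> (real, 'n) vec. f (snd p))"
    by (intro continuous_on_compose2[OF f] continuous_intros) auto
  have "closed (sym_matrices :: 'n sqmat set)"
    by (rule closed_subspace[OF subspace_sym_matrices])
  then have sym: "closed {p :: 'n sqmat \<times> (real, 'n) vec. fst p \<in> sym_matrices}"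
    using closed_vimage_fst by (simp add: vimage_def)
  have "lifted_level_set f r A bl bu m s v = {p. fst p \<in> sym_matrices \<and> f (snd p) \<le> 0 \<and>
     (\<forall>i j. i \<le> j \<longrightarrow> snd p $ j \<le> snd p $ i) \<and>
     snd p $ idx (s - 1) = 0 \<and> snd p $ idx (s + CARD('n) - r - 1 - 1) = 0 \<and>
     (\<forall>B. orthonormal B \<longrightarrow> (\<Sum>v\<in>B. fst p \<bullet> outer v v) \<le> (\<Sum>i<card B. snd p $ idx i)) \<and>
     (\<Sum>i\<in>UNIV. snd p $ i) = (\<Sum>i\<in>UNIV. fst p $ i $ i) \<and>
     (\<forall>i. i \<in> {1..m} \<longrightarrow> bl i \<le> ereal (A i \<bullet> fst p) \<and> ereal (A i \<bullet> fst p) \<le> bu i) \<and> A 0 \<bullet> fst p = v}"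
    using lifted_level_set_ky_fan[OF r s, of _ _ f A bl bu m v] by (auto simp del: One_nat_def)
  also have "closed \<dots>"
    by (intro closed_Collect_conj closed_Collect_all closed_Collect_imp open_Collect_const sym
        closed_Collect_le closed_Collect_eq fsnd continuous_intros)
  finally show ?thesis .
qed

lemma convex_ereal_interval: "convex {t. l \<le> ereal t \<and> ereal t \<le> h}"
proof -
  have "is_interval {t. l \<le> ereal t \<and> ereal t \<le> h}"
    unfolding is_interval_1
  proof (intro ballI allI impI)
    fix a b x assume "a \<in> {t. l \<le> ereal t \<and> ereal t \<le> h}" "b \<in> {t. l \<le> ereal t \<and> ereal t \<le> h}"
      and "a \<le> x \<and> x \<le> b"
    then have "l \<le> ereal a" "ereal a \<le> ereal x" "ereal x \<le> ereal b" "ereal b \<le> h" by simp_all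
    then show "x \<in> {t. l \<le> ereal t \<and> ereal t \<le> h}" by (metis (mono_tags) mem_Collect_eq order_trans)
  qed
  then show ?thesis by (simp add: is_interval_convex_1)
qed

lemma convex_lifted_level_set:
  fixes f :: "real^'n::{finite,linorder} \<Rightarrow> real"
  assumes r: "r < CARD('n)" and s: "s \<in> {1..r + 1}" and f: "convex_on UNIV f"
  shows "convex (lifted_level_set f r A bl bu m s v)"
proof (rule convexI)
  fix P Q :: "'n sqmat \<times> (real, 'n) vec" and a b :: real
  assume P: "P \<in> lifted_level_set f r A bl bu m s v" and Q: "Q \<in> lifted_level_set f r A bl bu m s v"
    and ab: "0 \<le> a" "0 \<le> b" "a + b = 1"
  obtain X x Y y where XY: "P = (X, x)" "Q = (Y, y)" by (cases P; cases Q) auto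
  note X = P[unfolded XY lifted_level_set_ky_fan[OF r s]]
  note Y = Q[unfolded XY lifted_level_set_ky_fan[OF r s]]
  have "(a *\<^sub>R X + b *\<^sub>R Y, a *\<^sub>R x + b *\<^sub>R y) \<in> lifted_level_set f r A bl bu m s v"
    unfolding lifted_level_set_ky_fan[OF r s]
  proof (intro conjI allI impI ballI)
    show "a *\<^sub>R X + b *\<^sub>R Y \<in> sym_matrices"
      using X Y by (intro subspace_add subspace_scale subspace_sym_matrices) auto
    have "f (a *\<^sub>R x + b *\<^sub>R y) \<le> a * f x + b * f y"
      using f ab unfolding convex_on_def by auto
    also have "\<dots> \<le> 0" using X Y ab by (intro add_nonpos_nonpos mult_nonneg_nonpos) auto
    finally show "f (a *\<^sub>R x + b *\<^sub>R y) \<le> 0" .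
  next
    fix i j :: 'n assume "i \<le> j"
    then have "x $ j \<le> x $ i" "y $ j \<le> y $ i" using X Y by auto
    then show "(a *\<^sub>R x + b *\<^sub>R y) $ j \<le> (a *\<^sub>R x + b *\<^sub>R y) $ i"
      using ab by (auto intro!: add_mono mult_left_mono)
  next
    fix B :: "(real, 'n) vec set" assume B: "orthonormal B"
    have "(\<Sum>v\<in>B. (a *\<^sub>R X + b *\<^sub>R Y) \<bullet> outer v v) =
        a * (\<Sum>v\<in>B. X \<bullet> outer v v) + b * (\<Sum>v\<in>B. Y \<bullet> outer v v)"
      by (simp add: inner_add_left sum.distrib sum_distrib_left)
    also have "\<dots> \<le> a * (\<Sum>i<card B. x $ idx i) + b * (\<Sum>i<card B. y $ idx i)"
      using X Y B ab by (intro add_mono mult_left_mono) auto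
    also have "\<dots> = (\<Sum>i<card B. (a *\<^sub>R x + b *\<^sub>R y) $ idx i)"
      by (simp add: sum.distrib sum_distrib_left)
    finally show "(\<Sum>v\<in>B. (a *\<^sub>R X + b *\<^sub>R Y) \<bullet> outer v v) \<le> (\<Sum>i<card B. (a *\<^sub>R x + b *\<^sub>R y) $ idx i)" .
  next
    have "(\<Sum>i\<in>UNIV. (a *\<^sub>R x + b *\<^sub>R y) $ i) = a * (\<Sum>i\<in>UNIV. x $ i) + b * (\<Sum>i\<in>UNIV. y $ i)"
      by (simp add: sum.distrib sum_distrib_left)
    also have "(\<Sum>i\<in>UNIV. x $ i) = (\<Sum>i\<in>UNIV. X $ i $ i)" using X by blast
    also have "(\<Sum>i\<in>UNIV. y $ i) = (\<Sum>i\<in>UNIV. Y $ i $ i)" using Y by blast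
    finally show "(\<Sum>i\<in>UNIV. (a *\<^sub>R x + b *\<^sub>R y) $ i) = (\<Sum>i\<in>UNIV. (a *\<^sub>R X + b *\<^sub>R Y) $ i $ i)"
      by (simp add: sum.distrib sum_distrib_left)
  next
    fix i assume i: "i \<in> {1..m}"
    let ?I = "{t. bl i \<le> ereal t \<and> ereal t \<le> bu i}"
    have "bl i \<le> ereal (A i \<bullet> X) \<and> ereal (A i \<bullet> X) \<le> bu i" using X i by blast
    moreover have "bl i \<le> ereal (A i \<bullet> Y) \<and> ereal (A i \<bullet> Y) \<le> bu i" using Y i by blast
    ultimately have "A i \<bullet> X \<in> ?I" "A i \<bullet> Y \<in> ?I" by simp_all
    then have "a *\<^sub>R (A i \<bullet> X) + b *\<^sub>R (A i \<bullet> Y) \<in> ?I"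
      using convex_ereal_interval ab by (intro convexD)
    then show "bl i \<le> ereal (A i \<bullet> (a *\<^sub>R X + b *\<^sub>R Y))" "ereal (A i \<bullet> (a *\<^sub>R X + b *\<^sub>R Y)) \<le> bu i"
      by (simp_all add: inner_add_right)
  next
    have "A 0 \<bullet> (a *\<^sub>R X + b *\<^sub>R Y) = (a + b) * v"
      using X Y by (simp add: inner_add_right distrib_right)
    then show "A 0 \<bullet> (a *\<^sub>R X + b *\<^sub>R Y) = v" using ab by simp
  qed (use X Y in auto)
  then show "a *\<^sub>R P + b *\<^sub>R Q \<in> lifted_level_set f r A bl bu m s v" by (simp add: XY)
qed

lemma slope_zero_of_bounded_below:
  fixes c d :: real
  assumes "\<And>t. c + t * d \<ge> 0"
  shows "d = 0"
proof (rule ccontr)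
  assume "d \<noteq> 0"
  then have "c + (- (c + 1) / d) * d = - 1" by simp
  then show False using assms[of "- (c + 1) / d"] by simp
qed

text \<open>
  A line with constant matrix would move the witness along a constant vector, which the zero block
  forbids. So a line in the lifted set projects to a line.
\<close>

lemma line_free_lifted_level_set:
  fixes f :: "real^'n::{finite,linorder} \<Rightarrow> real"
  assumes r: "r < CARD('n)" and s: "s \<in> {1..r + 1}"
    and no_line: "\<not> contains_line (feasible_set f r A bl bu m s)"
  shows "\<not> contains_line (lifted_level_set f r A bl bu m s v)"
proof
  assume "contains_line (lifted_level_set f r A bl bu m s v)"
  then obtain P E where E: "E \<noteq> 0" and line: "\<And>t. P + t *\<^sub>R E \<in> lifted_level_set f r A bl bu m s v"
    unfolding contains_line_def by blast
  obtain X x D d where PE: "P = (X, x)" "E = (D, d)" by (cases P; cases E) auto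
  have Z: "(X + t *\<^sub>R D, x + t *\<^sub>R d) \<in> lifted_level_set f r A bl bu m s v" for t
    using line[of t] by (simp add: PE)
  have "X + t *\<^sub>R D \<in> feasible_set f r A bl bu m s" for t
    using Z[of t] unfolding lifted_level_set_def feasible_set_def relax_set_def by blast
  then have D: "D = 0" using no_line unfolding contains_line_def by blast
  note Zt = Z[unfolded lifted_level_set_ky_fan[OF r s]]
  have const: "d $ i = d $ j" if "i \<le> j" for i j
  proof -
    have "(x $ i - x $ j) + t * (d $ i - d $ j) \<ge> 0" for t
    proof -
      have "(x + t *\<^sub>R d) $ j \<le> (x + t *\<^sub>R d) $ i" using Zt[of t] that by blast
      then show ?thesis by (simp add: algebra_simps)
    qed
    then have "d $ i - d $ j = 0" by (rule slope_zero_of_bounded_below)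
    then show ?thesis by simp
  qed
  have "x $ idx (s - 1) + t * d $ idx (s - 1) = 0" for t
    using Zt[of t] by simp
  from this[of 0] this[of 1] have "d $ idx (s - 1) = 0" by simp
  then have "d $ i = 0" for i using const[of i "idx (s - 1)"] const[of "idx (s - 1)" i] by (metis linear)
  then have "d = 0" by (simp add: vec_eq_iff)
  then show False using E D PE by (simp add: zero_prod_def)
qed

lemma perturbation_feasible:
  fixes X :: "'n::{finite,linorder} sqmat"
  assumes "Y \<in> sym_matrices" "f x \<le> 0" "nonincreasing x"
    "vec_comp x s = 0" "vec_comp x (s + CARD('n) - r - 1) = 0" "x \<succeq> eigvals Y"
    and "X \<in> feasible_set f r A bl bu m s" "\<And>i. i \<in> {1..m} \<Longrightarrow> A i \<bullet> Y = A i \<bullet> X"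
  shows "Y \<in> feasible_set f r A bl bu m s"
  using assms unfolding feasible_set_def relax_set_def by auto

lemma feasible_extreme_point_excess_bound:
  fixes X :: "'n::{finite,linorder} sqmat"
  assumes s: "s \<in> {1..r + 1}" and ext: "X extreme_point_of feasible_set f r A bl bu m s"
  shows "excess_bound r s (dim (A ` {1..m})) (rank X)"
proof (cases "r < CARD('n)")
  case False
  then show ?thesis by (intro excess_bound_full_rank) simp
next
  case True
  have X: "X \<in> feasible_set f r A bl bu m s" using ext by (simp add: extreme_point_of_def)
  then obtain x where x: "X \<in> sym_matrices" "f x \<le> 0" "nonincreasing x"
    "vec_comp x s = 0" "vec_comp x (s + CARD('n) - r - 1) = 0" "x \<succeq> eigvals X"
    using True unfolding feasible_set_def relax_set_def by blast
  show ?thesis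
    using perturbable_or_low_rank[OF x(1,3) True s x(4,5,6), of "A ` {1..m}"]
  proof
    assume "\<exists>D. D \<noteq> 0 \<and> X + D \<in> sym_matrices \<and> X - D \<in> sym_matrices \<and>
      (\<forall>a\<in>A ` {1..m}. a \<bullet> D = 0) \<and> x \<succeq> eigvals (X + D) \<and> x \<succeq> eigvals (X - D)"
    then obtain D where D: "D \<noteq> 0" "X + D \<in> sym_matrices" "X - D \<in> sym_matrices"
      "\<And>a. a \<in> A ` {1..m} \<Longrightarrow> a \<bullet> D = 0" "x \<succeq> eigvals (X + D)" "x \<succeq> eigvals (X - D)" by blast
    have "X + D \<in> feasible_set f r A bl bu m s" "X - D \<in> feasible_set f r A bl bu m s"
      using D(4)
      by (auto intro!: perturbation_feasible[OF _ x(2,3,4,5) _ X] D simp: inner_add_right inner_diff_right)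
    then show ?thesis using extreme_point_perturbation[OF ext] D(1) by blast
  qed (simp add: excess_bound_def)
qed

text \<open>
  At an optimal matrix a perturbation that is feasible in both directions cannot change the
  objective. So the perturbations stay in the lifted level set, although \<open>A 0\<close> is not among the
  constraints that they are chosen orthogonal to.
\<close>

lemma optimal_solution_excess_bound:
  fixes f :: "real^'n::{finite,linorder} \<Rightarrow> real"
  assumes f: "continuous_on UNIV f" "convex_on UNIV f"
    and no_line: "\<And>s. s \<in> {1..r + 1} \<Longrightarrow> \<not> contains_line (feasible_set f r A bl bu m s)"
    and opt: "optimal_solution f r A bl bu m X0"
  obtains X s where "optimal_solution f r A bl bu m X" "excess_bound r s (dim (A ` {1..m})) (rank X)"
proof (cases "r < CARD('n)")
  case False
  then show ?thesis by (intro that[OF opt] excess_bound_full_rank) simp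
next
  case r: True
  obtain s where s: "s \<in> {1..r + 1}" and X0: "X0 \<in> feasible_set f r A bl bu m s"
    and val: "ereal (A 0 \<bullet> X0) = opt_value f r A bl bu m"
    using opt unfolding optimal_solution_def by blast
  let ?Z = "lifted_level_set f r A bl bu m s (A 0 \<bullet> X0)"
  obtain x0 where "X0 \<in> sym_matrices \<and> f x0 \<le> 0 \<and> nonincreasing x0 \<and>
     vec_comp x0 s = 0 \<and> vec_comp x0 (s + CARD('n) - r - 1) = 0 \<and> x0 \<succeq> eigvals X0"
    using X0 r unfolding feasible_set_def relax_set_def by blast
  moreover have "\<forall>i\<in>{1..m}. bl i \<le> ereal (A i \<bullet> X0) \<and> ereal (A i \<bullet> X0) \<le> bu i"
    using X0 unfolding feasible_set_def by blast
  ultimately have "(X0, x0) \<in> ?Z" unfolding lifted_level_set_def by blast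
  then have "?Z \<noteq> {}" by blast
  then have "\<exists>P. P extreme_point_of ?Z"
    by (intro closed_convex_line_free_has_extreme_point closed_lifted_level_set[OF r s f(1)]
        convex_lifted_level_set[OF r s f(2)] line_free_lifted_level_set[OF r s no_line[OF s]])
  then obtain X x where ext: "(X, x) extreme_point_of ?Z" by auto
  then have Xx: "(X, x) \<in> ?Z" by (simp add: extreme_point_of_def)
  then have x: "X \<in> sym_matrices" "f x \<le> 0" "nonincreasing x"
    "vec_comp x s = 0" "vec_comp x (s + CARD('n) - r - 1) = 0" "x \<succeq> eigvals X"
    and AX: "A 0 \<bullet> X = A 0 \<bullet> X0"
    unfolding lifted_level_set_def by auto
  have X: "X \<in> feasible_set f r A bl bu m s"
    using Xx unfolding lifted_level_set_def feasible_set_def relax_set_def by blast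
  have "optimal_solution f r A bl bu m X"
    using X s AX val unfolding optimal_solution_def by auto
  moreover have "excess_bound r s (dim (A ` {1..m})) (rank X)"
    using perturbable_or_low_rank[OF x(1,3) r s x(4,5,6), of "A ` {1..m}"]
  proof
    assume "\<exists>D. D \<noteq> 0 \<and> X + D \<in> sym_matrices \<and> X - D \<in> sym_matrices \<and>
      (\<forall>a\<in>A ` {1..m}. a \<bullet> D = 0) \<and> x \<succeq> eigvals (X + D) \<and> x \<succeq> eigvals (X - D)"
    then obtain D where D: "D \<noteq> 0" "X + D \<in> sym_matrices" "X - D \<in> sym_matrices"
      "\<And>a. a \<in> A ` {1..m} \<Longrightarrow> a \<bullet> D = 0" "x \<succeq> eigvals (X + D)" "x \<succeq> eigvals (X - D)" by blast
    have feas: "X + D \<in> feasible_set f r A bl bu m s" "X - D \<in> feasible_set f r A bl bu m s"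
      using D(4)
      by (auto intro!: perturbation_feasible[OF _ x(2,3,4,5) _ X] D simp: inner_add_right inner_diff_right)
    have lower: "A 0 \<bullet> X \<le> A 0 \<bullet> Y" if "Y \<in> feasible_set f r A bl bu m s" for Y
    proof -
      have "opt_value f r A bl bu m \<le> ereal (A 0 \<bullet> Y)"
        unfolding opt_value_def by (rule INF_lower2[OF s]) (rule INF_lower[OF that])
      then show ?thesis using val AX by (metis ereal_less_eq(3))
    qed
    have "A 0 \<bullet> D = 0"
      using lower[OF feas(1)] lower[OF feas(2)] by (simp add: inner_add_right inner_diff_right)
    then have "(X + D, x) \<in> ?Z" "(X - D, x) \<in> ?Z"
      using feas D x AX unfolding lifted_level_set_def feasible_set_def
      by (auto simp: inner_add_right inner_diff_right)
    then have "(D, 0::real^'n::{finite,linorder}) = 0"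
      by (intro extreme_point_perturbation[OF ext]) simp_all
    then show ?thesis using D(1) by (simp add: zero_prod_def)
  qed (simp add: excess_bound_def)
  ultimately show ?thesis using that by blast
qed

theorem theorem7:
  fixes f :: "real ^ 'n::{finite,linorder} \<Rightarrow> real"
    and A :: "nat \<Rightarrow> 'n sqmat"
    and bl bu :: "nat \<Rightarrow> ereal"
    and k m r mt :: nat
  assumes k: "1 \<le> k" "k \<le> CARD('n)"
    and f_cont: "continuous_on UNIV f"
    and f_convex: "convex_on UNIV f"
    and f_sym: "symmetric_fun f"
    and A_sym: "\<And>i. i \<le> m \<Longrightarrow> A i \<in> sym_matrices"
    and bounds: "\<And>i. i \<in> {1..m} \<Longrightarrow> bl i \<le> bu i"
    and r_def: "r = strengthened_rank f k"
    and mt_def: "mt = dim (span (A ` {1..m}))"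
    and no_line: "\<And>s. s \<in> {1..r + 1} \<Longrightarrow> \<not> contains_line (feasible_set f r A bl bu m s)"
  shows "(\<forall>s\<in>{1..r + 1}. \<forall>X. X extreme_point_of feasible_set f r A bl bu m s \<longrightarrow>
           (if s = 1 \<or> s = r + 1
            then int (rank X) \<le> int r + \<lfloor>sqrt (2 * real mt + 9 / 4) - 3 / 2\<rfloor>
            else int (rank X) \<le> int r + \<lfloor>sqrt (4 * real mt + 9) - 3\<rfloor>)) \<and>
         (opt_value f r A bl bu m > -\<infinity> \<longrightarrow> (\<exists>X. optimal_solution f r A bl bu m X) \<longrightarrow>
           (\<exists>X. optimal_solution f r A bl bu m X \<and>
                int (rank X) \<le> int r + \<lfloor>sqrt (4 * real mt + 9) - 3\<rfloor>))"
proof (intro conjI ballI allI impI)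
  have mt: "mt = dim (A ` {1..m})" using mt_def by simp
  fix s X assume s: "s \<in> {1..r + 1}" and ext: "X extreme_point_of feasible_set f r A bl bu m s"
  have "excess_bound r s mt (rank X)"
    unfolding mt by (rule feasible_extreme_point_excess_bound[OF s ext])
  then show "if s = 1 \<or> s = r + 1
      then int (rank X) \<le> int r + \<lfloor>sqrt (2 * real mt + 9 / 4) - 3 / 2\<rfloor>
      else int (rank X) \<le> int r + \<lfloor>sqrt (4 * real mt + 9) - 3\<rfloor>"
    using excess_bound_one_sided excess_bound_two_sided by simp
next
  have mt: "mt = dim (A ` {1..m})" using mt_def by simp
  assume "\<exists>X. optimal_solution f r A bl bu m X"
  then obtain X s where "optimal_solution f r A bl bu m X" "excess_bound r s mt (rank X)"
    unfolding mt using optimal_solution_excess_bound[OF f_cont f_convex no_line] by blast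
  then show "\<exists>X. optimal_solution f r A bl bu m X \<and>
      int (rank X) \<le> int r + \<lfloor>sqrt (4 * real mt + 9) - 3\<rfloor>"
    using excess_bound_two_sided by blast
qed

end
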